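(* For each $n\ge 1$ let $\boldsymbol M_n$ be a uniform random meandric system of size $n$, and let $\mathrm{cc}(\boldsymbol M_n)$ be its number of connected components. Then there exists a constant $\kappa\in(0,1)$ such that $\mathrm{cc}(\boldsymbol M_n)/n\to\kappa$ in probability as $n\to\infty$.
   Context: A matching of size $n$ is a partition of $\{0,\dots,2n-1\}$ into sets of size $2$ (pairs); it is non-crossing if there are no two pairs $\{i,k\},\{j,\ell\}$ with $i<j<k<\ell$. A meandric system of size $n$ is an ordered pair of non-crossing matchings of size $n$ (drawn respectively above and below the same horizontal line); there are $\mathrm{Cat}_n^2$ of them, with $\mathrm{Cat}_n=\frac1{n+1}\binom{2n}{n}$. The two matchings together define a (multi-)graph on $\{0,\dots,2n-1\}$ whose edges are the pairs of both matchings; $\mathrm{cc}(M)$ denotes the number of connected components of this graph. *)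

theory Defs
  imports "HOL-Probability.Probability" "HOL-Library.Disjoint_Sets"
begin

definition matchings :: "nat \<Rightarrow> nat set set set" where
  "matchings n = {m. partition_on {0..<2 * n} m \<and> (\<forall>e\<in>m. card e = 2)}"

definition non_crossing :: "nat set set \<Rightarrow> bool" where
  "non_crossing m \<longleftrightarrow>
     \<not> (\<exists>i j k l. i < j \<and> j < k \<and> k < l \<and> {i, k} \<in> m \<and> {j, l} \<in> m)"

definition non_crossing_matchings :: "nat \<Rightarrow> nat set set set" where
  "non_crossing_matchings n = {m \<in> matchings n. non_crossing m}"

type_synonym meandric_system = "nat set set \<times> nat set set"

definition meandric_systems :: "nat \<Rightarrow> meandric_system set" where
  "meandric_systems n = non_crossing_matchings n \<times> non_crossing_matchings n"

definition adjacency :: "meandric_system \<Rightarrow> (nat \<times> nat) set" where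
  "adjacency M = {(a, b). {a, b} \<in> fst M \<union> snd M}"

text \<open>
  A component is represented by its vertex set, that is, by a class of the reachability relation.
  Edge multiplicities do not affect reachability. The vertex set is recovered as the union of the
  pairs, which is \<open>{0..<2 * n}\<close> for a meandric system of size \<open>n\<close>.
\<close>

definition components :: "meandric_system \<Rightarrow> nat set set" where
  "components M = \<Union> (fst M \<union> snd M) // (adjacency M)\<^sup>*"

definition cc :: "meandric_system \<Rightarrow> nat" where
  "cc M = card (components M)"

lemma finite_meandric_systems: "finite (meandric_systems n)"
proof -
  have "non_crossing_matchings n \<subseteq> Pow (Pow {0..<2 * n})"
    by (auto simp: non_crossing_matchings_def matchings_def partition_on_def)
  then have "finite (non_crossing_matchings n)"
    by (rule finite_subset) simp
  then show ?thesis
    by (simp add: meandric_systems_def)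
qed

lemma meandric_systems_nonempty: "meandric_systems n \<noteq> {}"
proof -
  let ?m = "(\<lambda>i. {2 * i, 2 * i + 1}) ` {0..<n}"
  have "\<Union> ?m = {0..<2 * n}"
  proof (intro equalityI subsetI)
    fix x assume "x \<in> {0..<2 * n}"
    then have "x div 2 \<in> {0..<n}" "x \<in> {2 * (x div 2), 2 * (x div 2) + 1}"
      by auto
    then show "x \<in> \<Union> ?m" by blast
  qed auto
  moreover have "disjoint ?m"
    unfolding disjoint_def by (auto; presburger)
  moreover have "{} \<notin> ?m" "\<forall>e\<in>?m. card e = 2" by auto
  moreover have "non_crossing ?m"
    unfolding non_crossing_def by (auto simp: doubleton_eq_iff)
  ultimately have "?m \<in> non_crossing_matchings n"
    by (simp add: non_crossing_matchings_def matchings_def partition_on_def)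
  then show ?thesis
    by (auto simp: meandric_systems_def)
qed

definition uniform_meandric_system :: "nat \<Rightarrow> meandric_system pmf" where
  "uniform_meandric_system n = pmf_of_set (meandric_systems n)"

end

theory Submission
  imports Defs "HOL-Real_Asymp.Real_Asymp"
begin

text \<open>
  Encode a meandric system of size \<open>n\<close> by the pair of Dyck words of its matchings and cut the
  \<open>2 * n\<close> letters into blocks of a fixed length \<open>L\<close>. A component contained in a block is determined
  by the letters of that block, and any other component contains a vertex one of whose arcs leaves
  its block, or a vertex of the incomplete last block. Hence \<open>cc\<close> is at least the sum over the blocks
  of the number of loops inside the block, and exceeds it by at most the number of vertices unmatched
  in their block, plus \<open>L\<close>. For independent uniform letters both sums are concentrated
  exponentially (Hoeffding), and the pair of words is Dyck with only polynomially small probability,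
  so both sums are concentrated for the uniform meandric system as well. The density of vertices
  unmatched in their block vanishes as \<open>L\<close> grows, because the height of a random walk of length \<open>L\<close>
  is \<open>o(L)\<close>. Thus \<open>\<kappa>\<close> is the supremum of the expected loop densities of blocks. It is positive
  because of loops on two adjacent vertices, and less than one because a positive density of
  vertices lies in no loop of size two.
\<close>

subsection \<open>Parenthesis matching\<close>

definition height :: "(nat \<Rightarrow> bool) \<Rightarrow> nat \<Rightarrow> int" where
  "height s k = (\<Sum>l<k. if s l then 1 else - 1)"

text \<open>Step \<open>j\<close> is the first return of the walk to its height at \<open>i\<close>.
  In this form arcs make sense for arbitrary, possibly unbalanced words, and they depend only on the
  letters from \<open>i\<close> to \<open>j\<close>.\<close>

definition match :: "(nat \<Rightarrow> bool) \<Rightarrow> nat \<Rightarrow> nat \<Rightarrow> bool" where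
  "match s i j \<longleftrightarrow> i < j \<and> height s (Suc j) = height s i \<and>
     (\<forall>k. i < k \<and> k \<le> j \<longrightarrow> height s i < height s k)"

definition partner :: "(nat \<Rightarrow> bool) \<Rightarrow> nat \<Rightarrow> nat \<Rightarrow> bool" where
  "partner s i j \<longleftrightarrow> match s i j \<or> match s j i"

lemma height_0 [simp]: "height s 0 = 0"
  by (simp add: height_def)

lemma height_Suc: "height s (Suc k) = height s k + (if s k then 1 else - 1)"
  by (simp add: height_def)

lemma height_cong: "(\<And>l. l < k \<Longrightarrow> s l = s' l) \<Longrightarrow> height s k = height s' k"
  by (auto simp: height_def intro!: sum.cong)

lemma height_shift: "height s (a + k) = height s a + height (\<lambda>l. s (a + l)) k"
  by (induction k) (auto simp: height_Suc)

lemma match_shift: "match s (a + i) (a + j) \<longleftrightarrow> match (\<lambda>l. s (a + l)) i j"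
proof -
  have "(\<forall>k. a + i < k \<and> k \<le> a + j \<longrightarrow> height s (a + i) < height s k) \<longleftrightarrow>
        (\<forall>k. i < k \<and> k \<le> j \<longrightarrow> height s (a + i) < height s (a + k))" (is "?l = ?r")
  proof
    assume ?r
    show ?l
    proof (intro allI impI)
      fix k assume "a + i < k \<and> k \<le> a + j"
      then show "height s (a + i) < height s k"
        using \<open>?r\<close>[rule_format, of "k - a"] by (simp add: less_diff_conv add.commute le_diff_conv)
    qed
  qed auto
  then show ?thesis
    unfolding match_def using height_shift[of s a "Suc j"] by (simp add: height_shift)
qed

lemma match_cong:
  assumes "\<And>l. l < L \<Longrightarrow> s l = s' l" "j < L"
  shows "match s i j \<longleftrightarrow> match s' i j"
proof -
  have *: "height s k = height s' k" if "k \<le> L" for k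
    using assms that by (intro height_cong) auto
  show ?thesis
    unfolding match_def using assms(2) by (auto simp: *)
qed

lemma match_less: "match s i j \<Longrightarrow> i < j"
  by (simp add: match_def)

lemma match_open: "match s i j \<Longrightarrow> s i"
  unfolding match_def by (auto simp: height_Suc split: if_splits dest!: spec[of _ "Suc i"])

lemma match_close: "match s i j \<Longrightarrow> \<not> s j"
  unfolding match_def by (auto simp: height_Suc split: if_splits dest!: spec[of _ j])

lemma match_unique_right:
  assumes "match s i j" "match s i j'"
  shows "j = j'"
proof -
  have "\<not> j < j'" if "match s i j" "match s i j'" for j j'
    using that unfolding match_def by (auto dest!: spec[of _ "Suc j"])
  then show ?thesis using assms by (meson linorder_neqE_nat)
qed

lemma match_unique_left:
  assumes "match s i j" "match s i' j"
  shows "i = i'"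
proof -
  have "\<not> i < i'" if "match s i j" "match s i' j" for i i'
    using that unfolding match_def by (auto dest!: spec[of _ i'])
  then show ?thesis using assms by (meson linorder_neqE_nat)
qed

text \<open>A matched letter opens an arc or closes one but never both, so the two cases of
  \<open>partner\<close> cannot mix.\<close>

lemma partner_unique: "partner s i j \<Longrightarrow> partner s i j' \<Longrightarrow> j = j'"
  unfolding partner_def
  by (metis match_unique_right match_unique_left match_open match_close)

lemma partner_sym: "partner s i j \<Longrightarrow> partner s j i"
  by (auto simp: partner_def)

lemma partner_neq: "partner s i j \<Longrightarrow> i \<noteq> j"
  by (auto simp: partner_def match_def)

lemma partner_shift: "partner s (a + i) (a + j) \<longleftrightarrow> partner (\<lambda>l. s (a + l)) i j"
  by (simp add: partner_def match_shift)

lemma partner_cong: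
  assumes "\<And>l. l < L \<Longrightarrow> s l = s' l" "i < L" "j < L"
  shows "partner s i j \<longleftrightarrow> partner s' i j"
  using match_cong[of L s s' j i] match_cong[of L s s' i j] assms by (simp add: partner_def)

section \<open>Existence of partners and the number of unmatched letters\<close>

text \<open>Discrete intermediate values: the walk rises above \<open>height s v\<close> at once and
  moves by unit steps, so the first step that brings it down to that level hits the level
  exactly.\<close>

lemma opener_match_exists:
  assumes "s v" "v < k" "height s k \<le> height s v"
  shows "\<exists>j<k. match s v j"
proof -
  let ?P = "\<lambda>j. v < j \<and> height s (Suc j) \<le> height s v"
  have hv: "height s (Suc v) = height s v + 1" using assms(1) by (simp add: height_Suc)
  then have "k \<noteq> Suc v" using assms(3) by auto
  then have P: "?P (k - 1)" using assms(2,3) by auto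
  define j where "j = (LEAST j. ?P j)"
  have j: "?P j" "j \<le> k - 1"
    unfolding j_def using LeastI[of ?P, OF P] Least_le[of ?P, OF P] by simp_all
  have least: "\<not> ?P i" if "i < j" for i using that not_less_Least unfolding j_def by blast
  have above: "height s v < height s i" if "v < i" "i \<le> j" for i
  proof (cases "i = Suc v")
    case False
    then show ?thesis using that least[of "i - 1"] by (auto simp: not_le)
  qed (use hv in simp)
  have "height s (Suc j) = height s v"
    using j(1) above[of j] by (auto simp: height_Suc split: if_splits)
  then have "match s v j" using j above by (auto simp: match_def)
  then show ?thesis using j(2) assms(2) by (intro exI[of _ j]) auto
qed

text \<open>Mirror image of the preceding argument: the match starts at the last earlier time at
  which the walk is not above its height after step \<open>v\<close>.\<close>

lemma closer_match_exists:
  assumes "\<not> s v" "k \<le> v" "height s k \<le> height s (Suc v)"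
  shows "\<exists>i<v. match s i v"
proof -
  let ?P = "\<lambda>i. i \<le> v \<and> height s i \<le> height s (Suc v)"
  have hv: "height s (Suc v) = height s v - 1" using assms(1) by (simp add: height_Suc)
  have P: "?P k" using assms by simp
  define i where "i = (GREATEST i. ?P i)"
  have i: "?P i" unfolding i_def by (rule GreatestI_nat[of ?P k v]) (use P in auto)
  have greatest: "l \<le> i" if "?P l" for l
    unfolding i_def by (rule Greatest_le_nat[of ?P l v]) (use that in auto)
  have "i < v" using i hv by (cases "i = v") auto
  have above: "height s (Suc v) < height s l" if "i < l" "l \<le> v" for l
    using that greatest[of l] by (meson not_le)
  have "height s (Suc v) = height s i"
    using i above[of "Suc i"] \<open>i < v\<close> by (auto simp: height_Suc split: if_splits)
  then show ?thesis using \<open>i < v\<close> above by (intro exI[of _ i]) (auto simp: match_def)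
qed

text \<open>Unmatched openers have strictly increasing heights, unmatched closers strictly decreasing ones.\<close>

lemma card_unmatched_le:
  fixes m :: real
  assumes m: "\<And>k. k \<le> L \<Longrightarrow> \<bar>real_of_int (height s k)\<bar> \<le> m"
  shows "real (card {v. v < L \<and> \<not> (\<exists>u<L. partner s v u)}) \<le> 4 * m + 2"
proof -
  let ?O = "{v. v < L \<and> s v \<and> \<not> (\<exists>u<L. partner s v u)}"
  let ?C = "{v. v < L \<and> \<not> s v \<and> \<not> (\<exists>u<L. partner s v u)}"
  let ?I = "{- \<lfloor>m\<rfloor>..\<lfloor>m\<rfloor>}"
  have "0 \<le> m" using m[of 0] by simp
  have I: "height s k \<in> ?I" if "k \<le> L" for k
  proof -
    have "height s k \<le> \<lfloor>m\<rfloor>" "- height s k \<le> \<lfloor>m\<rfloor>"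
      using m[OF that] by (simp_all add: le_floor_iff abs_le_iff)
    then show ?thesis by simp
  qed
  have up: "height s v < height s v'" if v: "v \<in> ?O" "v < v'" "v' \<le> L" for v v'
  proof (rule ccontr)
    assume "\<not> height s v < height s v'"
    then obtain j where "j < v'" "match s v j" using opener_match_exists[of s v v'] v by auto
    then have "j < L" "partner s v j" using v(3) by (auto simp: partner_def)
    then show False using v(1) by blast
  qed
  have "inj_on (height s) ?O"
  proof (rule inj_onI)
    fix v v' assume "v \<in> ?O" "v' \<in> ?O" "height s v = height s v'"
    then show "v = v'" using up[of v v'] up[of v' v] by (cases v v' rule: linorder_cases) simp_all
  qed
  then have O: "card ?O \<le> card ?I" by (rule card_inj_on_le) (use I in auto)
  have down: "height s (Suc v') < height s (Suc v)" if v: "v' \<in> ?C" "v < v'" for v v'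
  proof (rule ccontr)
    assume "\<not> height s (Suc v') < height s (Suc v)"
    then obtain i where "i < v'" "match s i v'" using closer_match_exists[of s v' "Suc v"] v by auto
    then have "i < L" "partner s v' i" using v(1) by (auto simp: partner_def)
    then show False using v(1) by blast
  qed
  have "inj_on (\<lambda>v. height s (Suc v)) ?C"
  proof (rule inj_onI)
    fix v v' assume "v \<in> ?C" "v' \<in> ?C" "height s (Suc v) = height s (Suc v')"
    then show "v = v'" using down[of v v'] down[of v' v] by (cases v v' rule: linorder_cases) simp_all
  qed
  then have C: "card ?C \<le> card ?I" by (rule card_inj_on_le) (use I in auto)
  have "{v. v < L \<and> \<not> (\<exists>u<L. partner s v u)} = ?O \<union> ?C" by auto
  then have "card {v. v < L \<and> \<not> (\<exists>u<L. partner s v u)} \<le> card ?O + card ?C"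
    using card_Un_le[of ?O ?C] by (simp only:)
  also have "\<dots> \<le> 2 * card ?I" using O C by linarith
  finally have "card {v. v < L \<and> \<not> (\<exists>u<L. partner s v u)} \<le> 2 * card ?I" .
  \<comment> \<open>There are at most \<open>2 * m + 1\<close> integer heights, and each of the two
    injections uses them once; this gives \<open>4 * m + 2\<close>.\<close>
  moreover have "real (card ?I) \<le> 2 * m + 1" using \<open>0 \<le> m\<close> by simp
  ultimately show ?thesis by linarith
qed

subsection \<open>Loops of a pair of words\<close>

text \<open>Letter \<open>i\<close> records whether \<open>i\<close> opens an arc of the upper, respectively lower, matching.\<close>

type_synonym word = "nat \<Rightarrow> bool \<times> bool"

abbreviation (input) shift :: "nat \<Rightarrow> (nat \<Rightarrow> 'a) \<Rightarrow> nat \<Rightarrow> 'a" where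
  "shift a w \<equiv> (\<lambda>l. w (a + l))"

definition linked :: "word \<Rightarrow> nat set \<Rightarrow> nat \<Rightarrow> bool" where
  "linked w C v \<longleftrightarrow> (\<exists>u\<in>C. partner (fst \<circ> w) v u) \<and> (\<exists>u\<in>C. partner (snd \<circ> w) v u)"

definition closed_set :: "word \<Rightarrow> nat set \<Rightarrow> bool" where
  "closed_set w C \<longleftrightarrow> (\<forall>v\<in>C. linked w C v)"

text \<open>
  Closed components are described as minimal sets closed under both partner relations, rather than
  by reachability: whether \<open>C\<close> is a loop then visibly depends only on the letters in any interval
  containing \<open>C\<close>.
\<close>

definition loop :: "word \<Rightarrow> nat set \<Rightarrow> bool" where
  "loop w C \<longleftrightarrow> C \<noteq> {} \<and> closed_set w C \<and> (\<forall>C'\<subseteq>C. C' \<noteq> {} \<longrightarrow> closed_set w C' \<longrightarrow> C' = C)"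

definition loops :: "word \<Rightarrow> nat set \<Rightarrow> nat set set" where
  "loops w I = {C. C \<subseteq> I \<and> loop w C}"

text \<open>The vertices through which a component can leave \<open>I\<close>. A vertex without any
  partner counts as well, as can happen in words that are not Dyck.\<close>

definition unlinked :: "word \<Rightarrow> nat set \<Rightarrow> nat set" where
  "unlinked w I = {v \<in> I. \<not> linked w I v}"

lemma linked_shift: "linked w ((+) a ` C) (a + v) \<longleftrightarrow> linked (shift a w) C v"
  by (simp add: linked_def partner_shift o_def)

lemma linked_cong:
  assumes "\<And>l. l < L \<Longrightarrow> w l = w' l" "C \<subseteq> {..<L}" "v < L"
  shows "linked w C v \<longleftrightarrow> linked w' C v"
proof -
  have "partner (f \<circ> w) v u \<longleftrightarrow> partner (f \<circ> w') v u" if "u \<in> C" for u and f :: "bool \<times> bool \<Rightarrow> bool"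
    using assms that by (intro partner_cong[of L]) auto
  then show ?thesis by (simp add: linked_def)
qed

text \<open>The witnesses in \<open>C\<close> and in \<open>D\<close> coincide because partners are
  unique. This makes closed sets stable under intersection.\<close>

lemma linked_Int:
  assumes "linked w C v" "linked w D v"
  shows "linked w (C \<inter> D) v"
  using assms unfolding linked_def by (blast dest: partner_unique)

lemma closed_set_shift: "closed_set w ((+) a ` C) \<longleftrightarrow> closed_set (shift a w) C"
  by (simp add: closed_set_def linked_shift)

lemma closed_set_cong:
  assumes "\<And>l. l < L \<Longrightarrow> w l = w' l" "C \<subseteq> {..<L}"
  shows "closed_set w C \<longleftrightarrow> closed_set w' C"
proof -
  have "linked w C v \<longleftrightarrow> linked w' C v" if "v \<in> C" for v
    using assms that by (intro linked_cong[of L]) auto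
  then show ?thesis by (simp add: closed_set_def)
qed

lemma loop_shift: "loop w ((+) a ` C) \<longleftrightarrow> loop (shift a w) C"
  unfolding loop_def all_subset_image closed_set_shift
  by (simp add: inj_image_eq_iff)

lemma loop_cong:
  assumes "\<And>l. l < L \<Longrightarrow> w l = w' l" "C \<subseteq> {..<L}"
  shows "loop w C \<longleftrightarrow> loop w' C"
proof -
  have "closed_set w C' \<longleftrightarrow> closed_set w' C'" if "C' \<subseteq> C" for C'
    using assms that by (intro closed_set_cong[of L]) auto
  then show ?thesis unfolding loop_def by auto
qed

lemma atLeastLessThan_shift: "{a..<a + L} = (+) a ` {..<(L::nat)}"
  by (simp add: lessThan_atLeast0 add.commute)

lemma card_loops_shift: "card (loops w {a..<a + L}) = card (loops (shift a w) {..<L})"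
proof -
  have "loops w {a..<a + L} = (`) ((+) a) ` loops (shift a w) {..<L}"
    unfolding atLeastLessThan_shift loops_def subset_image_iff
    by (auto simp: loop_shift)
  moreover have "inj_on ((`) ((+) a)) (loops (shift a w) {..<L})"
    by (auto intro!: inj_onI simp: inj_image_eq_iff)
  ultimately show ?thesis by (simp add: card_image)
qed

lemma card_unlinked_shift: "card (unlinked w {a..<a + L}) = card (unlinked (shift a w) {..<L})"
proof -
  have "unlinked w {a..<a + L} = (+) a ` unlinked (shift a w) {..<L}"
    unfolding atLeastLessThan_shift unlinked_def by (auto simp: linked_shift)
  then show ?thesis by (simp add: card_image)
qed

lemma loops_cong: "(\<And>l. l < L \<Longrightarrow> w l = w' l) \<Longrightarrow> loops w {..<L} = loops w' {..<L}"
  unfolding loops_def by (auto simp: loop_cong[of L w w'])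

lemma unlinked_cong: "(\<And>l. l < L \<Longrightarrow> w l = w' l) \<Longrightarrow> unlinked w {..<L} = unlinked w' {..<L}"
  unfolding unlinked_def by (auto simp: linked_cong[of L w w'])

lemma finite_loops: "finite I \<Longrightarrow> finite (loops w I)"
  unfolding loops_def by (rule finite_subset[of _ "Pow I"]) auto

lemma closed_set_Int: "closed_set w C \<Longrightarrow> closed_set w D \<Longrightarrow> closed_set w (C \<inter> D)"
  unfolding closed_set_def by (auto intro: linked_Int)

lemma loops_disjoint:
  assumes "loop w C" "loop w D" "C \<inter> D \<noteq> {}"
  shows "C = D"
proof -
  have "closed_set w (C \<inter> D)" using assms by (auto simp: loop_def intro: closed_set_Int)
  then show ?thesis using assms unfolding loop_def by (metis Int_lower1 Int_lower2)
qed

text \<open>No arc leads from \<open>C \<inter> I\<close> out of \<open>I\<close>, and none leads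
  out of \<open>C\<close>, so the intersection is closed and equals \<open>C\<close> by
  minimality.\<close>

lemma loop_subset_interval:
  assumes "loop w C" "C \<inter> I \<noteq> {}" "C \<inter> unlinked w I = {}"
  shows "C \<subseteq> I"
proof -
  have "closed_set w (C \<inter> I)"
    using assms unfolding closed_set_def loop_def unlinked_def by (auto intro: linked_Int)
  then show ?thesis using assms unfolding loop_def by (metis Int_lower1 Int_lower2)
qed

section \<open>Comparison of all loops with the loops inside blocks\<close>

text \<open>Loops are non-empty and the blocks are disjoint, so no loop is counted twice.\<close>

lemma sum_card_loops_blocks_le:
  assumes "q * L \<le> N"
  shows "(\<Sum>i<q. card (loops w {i * L..<i * L + L})) \<le> card (loops w {..<N})"
proof -
  have "(\<Sum>i<q. card (loops w {i * L..<i * L + L})) = card (\<Union>i<q. loops w {i * L..<i * L + L})"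
  proof (rule card_UN_disjoint[symmetric])
    show "\<forall>i\<in>{..<q}. \<forall>j\<in>{..<q}. i \<noteq> j \<longrightarrow>
      loops w {i * L..<i * L + L} \<inter> loops w {j * L..<j * L + L} = {}"
    proof (intro ballI impI, rule ccontr)
      fix i j assume "i \<noteq> j" "loops w {i * L..<i * L + L} \<inter> loops w {j * L..<j * L + L} \<noteq> {}"
      then obtain C where C: "C \<subseteq> {i * L..<i * L + L}" "C \<subseteq> {j * L..<j * L + L}" "C \<noteq> {}"
        unfolding loops_def loop_def by auto
      then obtain v where "v \<in> {i * L..<i * L + L}" "v \<in> {j * L..<j * L + L}" by blast
      then have "v div L = i" "v div L = j"
        by (auto intro!: div_nat_eqI simp: algebra_simps)
      then show False using \<open>i \<noteq> j\<close> by simp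
    qed
  qed (auto intro: finite_loops)
  also have "\<dots> \<le> card (loops w {..<N})"
  proof (rule card_mono[OF finite_loops])
    have "i * L + L \<le> N" if "i < q" for i
      using that assms mult_le_mono1[of "Suc i" q L] by auto
    then show "(\<Union>i<q. loops w {i * L..<i * L + L}) \<subseteq> loops w {..<N}"
      unfolding loops_def by fastforce
  qed auto
  finally show ?thesis .
qed

text \<open>A loop contained in no block meets the set \<open>V\<close> of unlinked vertices and
  leftover vertices, and distinct loops meet it in distinct vertices.\<close>

lemma card_loops_le_sum_blocks:
  assumes "L > 0"
  shows "card (loops w {..<N}) \<le> (\<Sum>i<q. card (loops w {i * L..<i * L + L})) +
           (\<Sum>i<q. card (unlinked w {i * L..<i * L + L})) + (N - q * L)"
proof -
  let ?B = "\<lambda>i. {i * L..<i * L + L}"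
  define G where "G = (\<Union>i<q. loops w (?B i))"
  define V where "V = (\<Union>i<q. unlinked w (?B i)) \<union> {q * L..<N}"
  have finV: "finite V" unfolding V_def unlinked_def by auto
  have meets: "C \<inter> V \<noteq> {}" if C: "C \<in> loops w {..<N} - G" for C
  proof
    assume disj: "C \<inter> V = {}"
    obtain v where v: "v \<in> C" using C unfolding loops_def loop_def by auto
    then have "v < N" "\<not> q * L \<le> v" using C disj unfolding loops_def V_def by fastforce+
    then have q: "v div L < q" using assms by (simp add: less_mult_imp_div_less)
    have "v \<in> ?B (v div L)"
      using dividend_less_div_times[OF assms, of v] by (simp add: add.commute)
    moreover have "C \<inter> unlinked w (?B (v div L)) = {}" using disj q unfolding V_def by auto
    ultimately have "C \<subseteq> ?B (v div L)"
      using C v by (intro loop_subset_interval[of w]) (auto simp: loops_def)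
    then have "C \<in> G" using q C unfolding G_def loops_def by auto
    then show False using C by auto
  qed
  \<comment> \<open>A vertex of \<open>V\<close> is chosen in each loop outside \<open>G\<close>.
    Disjointness of loops makes the choice injective, so there are at most \<open>card V\<close>
    such loops.\<close>
  define c where "c C = (SOME v. v \<in> C \<inter> V)" for C
  have c: "c C \<in> C \<inter> V" if "C \<in> loops w {..<N} - G" for C
    unfolding c_def using meets[OF that] by (metis some_in_eq)
  have "inj_on c (loops w {..<N} - G)"
  proof (rule inj_onI)
    fix C D assume "C \<in> loops w {..<N} - G" "D \<in> loops w {..<N} - G" "c C = c D"
    then show "C = D" using c[of C] c[of D] by (intro loops_disjoint[of w]) (auto simp: loops_def)
  qed
  then have bad: "card (loops w {..<N} - G) \<le> card V"
    using c finV by (intro card_inj_on_le[of c]) auto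
  have "card V \<le> (\<Sum>i<q. card (unlinked w (?B i))) + (N - q * L)"
    unfolding V_def
    by (rule order.trans[OF card_Un_le]) (auto intro!: card_UN_le)
  moreover have "card G \<le> (\<Sum>i<q. card (loops w (?B i)))"
    unfolding G_def by (intro card_UN_le) auto
  moreover have "card (loops w {..<N}) \<le> card ((loops w {..<N} - G) \<union> G)"
    by (intro card_mono) (auto simp: G_def intro: finite_loops)
  then have "card (loops w {..<N}) \<le> card (loops w {..<N} - G) + card G"
    using card_Un_le order.trans by blast
  ultimately show ?thesis using bad by linarith
qed

subsection \<open>Meandric systems as pairs of words\<close>

definition opener :: "nat set set \<Rightarrow> nat \<Rightarrow> bool" where
  "opener m i \<longleftrightarrow> (\<exists>j>i. {i, j} \<in> m)"

definition word_of :: "meandric_system \<Rightarrow> word" where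
  "word_of M = (\<lambda>i. (opener (fst M) i, opener (snd M) i))"

lemma matching_pair_less:
  assumes "m \<in> matchings n" "{i, j} \<in> m"
  shows "i < 2 * n" "j < 2 * n" "i \<noteq> j"
proof -
  have "card {i, j} = 2" "{i, j} \<subseteq> {0..<2 * n}"
    using assms by (auto simp: matchings_def partition_on_def)
  then show "i < 2 * n" "j < 2 * n" "i \<noteq> j" by auto
qed

lemma matching_pair_unique:
  assumes "m \<in> matchings n" "{i, j} \<in> m" "{i, k} \<in> m"
  shows "j = k"
proof -
  have "{i, j} = {i, k}"
  proof (rule ccontr)
    assume "{i, j} \<noteq> {i, k}"
    moreover have "disjoint m" using assms(1) by (simp add: matchings_def partition_on_def)
    ultimately have "{i, j} \<inter> {i, k} = {}" using assms(2,3) by (meson disjointD)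
    then show False by simp
  qed
  then show ?thesis by (auto simp: doubleton_eq_iff)
qed

lemma matching_pair_exists:
  assumes "m \<in> matchings n" "i < 2 * n"
  shows "\<exists>j. {i, j} \<in> m"
proof -
  have "i \<in> \<Union> m" using assms by (simp add: matchings_def partition_on_def)
  then obtain e where e: "e \<in> m" "i \<in> e" by blast
  then have "card e = 2" using assms by (auto simp: matchings_def)
  then obtain a b where "e = {a, b}" by (auto simp: card_2_iff)
  then show ?thesis using e by (auto simp: insert_commute)
qed

text \<open>The height counts the arcs passing over the gap just before \<open>k\<close>, for
  crossing matchings too: an opener adds its own arc, a closer removes the arc of its
  partner.\<close>

lemma height_opener:
  assumes m: "m \<in> matchings n" and "k \<le> 2 * n"
  shows "height (opener m) k = int (card {a. a < k \<and> (\<exists>b\<ge>k. {a, b} \<in> m)})"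
  using assms(2)
proof (induction k)
  case (Suc k)
  let ?T = "\<lambda>k. {a. a < k \<and> (\<exists>b\<ge>k. {a, b} \<in> m)}"
  obtain p where p: "{k, p} \<in> m" using matching_pair_exists[OF m, of k] Suc.prems by auto
  have "k \<noteq> p" using matching_pair_less[OF m p] by simp
  then show ?case
  proof (cases "k < p")
    case True
    have "?T (Suc k) = insert k (?T k)"
    proof (intro set_eqI iffI)
      fix a assume "a \<in> insert k (?T k)"
      then consider "a = k" | b where "a < k" "k \<le> b" "{a, b} \<in> m" by auto
      then show "a \<in> ?T (Suc k)"
      proof cases
        case 1
        then show ?thesis using p True by (auto intro!: exI[of _ p])
      next
        case 2
        have "b \<noteq> k" using 2 p True matching_pair_unique[OF m, of k a p] by (auto simp: insert_commute)
        then show ?thesis using 2 by (auto intro!: exI[of _ b])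
      qed
    next
      fix a assume "a \<in> ?T (Suc k)"
      then obtain b where "a < Suc k" "Suc k \<le> b" "{a, b} \<in> m" by auto
      then show "a \<in> insert k (?T k)" by (auto simp: less_Suc_eq intro!: exI[of _ b])
    qed
    moreover have "opener m k" using p True by (auto simp: opener_def)
    ultimately show ?thesis using Suc by (simp add: height_Suc)
  next
    case False
    with \<open>k \<noteq> p\<close> have "p < k" by simp
    have "?T k = insert p (?T (Suc k))"
    proof (intro set_eqI iffI)
      fix a assume "a \<in> ?T k"
      then obtain b where b: "a < k" "k \<le> b" "{a, b} \<in> m" by auto
      show "a \<in> insert p (?T (Suc k))"
      proof (cases "b = k")
        case True
        then show ?thesis using b p matching_pair_unique[OF m, of k a p] by (auto simp: insert_commute)
      qed (use b in auto)
    next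
      fix a assume "a \<in> insert p (?T (Suc k))"
      then consider "a = p" | b where "a < Suc k" "Suc k \<le> b" "{a, b} \<in> m" by auto
      then show "a \<in> ?T k"
      proof cases
        case 1
        then show ?thesis using p \<open>p < k\<close> by (auto intro!: exI[of _ k] simp: insert_commute)
      next
        case 2
        have "a \<noteq> k" using 2 p \<open>p < k\<close> matching_pair_unique[OF m, of k b p] by auto
        then show ?thesis using 2 by (auto intro!: exI[of _ b])
      qed
    qed
    moreover have "p \<notin> ?T (Suc k)"
    proof
      assume "p \<in> ?T (Suc k)"
      then obtain b where "Suc k \<le> b" "{p, b} \<in> m" by auto
      then show False using p matching_pair_unique[OF m, of p k b] by (simp add: insert_commute)
    qed
    moreover have "\<not> opener m k"
      unfolding opener_def using p \<open>p < k\<close> matching_pair_unique[OF m, of k p] by fastforce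
    ultimately show ?thesis using Suc by (simp add: height_Suc)
  qed
qed auto

text \<open>Since no arc crosses \<open>{i, j}\<close>, every arc over the gap before
  \<open>i\<close> stays over all gaps up to \<open>Suc j\<close>. The arc \<open>{i, j}\<close>
  itself raises the height strictly in between, and after \<open>j\<close> exactly the old arcs
  remain.\<close>

lemma non_crossing_match:
  assumes "m \<in> non_crossing_matchings n" "{i, j} \<in> m" "i < j"
  shows "match (opener m) i j"
proof -
  have m: "m \<in> matchings n"
    and nc: "\<And>a b c d. a < b \<Longrightarrow> b < c \<Longrightarrow> c < d \<Longrightarrow> {a, c} \<in> m \<Longrightarrow> {b, d} \<in> m \<Longrightarrow> False"
    using assms(1) by (auto simp: non_crossing_matchings_def non_crossing_def)
  let ?T = "\<lambda>k. {a. a < k \<and> (\<exists>b\<ge>k. {a, b} \<in> m)}"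
  note j2 = matching_pair_less[OF m assms(2)]
  have outside: "j < b" if "a < i" "i \<le> b" "{a, b} \<in> m" for a b
  proof -
    have "b \<noteq> i" "b \<noteq> j"
      using that assms(2,3) matching_pair_unique[OF m, of i a j] matching_pair_unique[OF m, of j a i]
      by (auto simp: insert_commute)
    then have "i < b" "\<not> b < j" using nc[of a i b j] that assms(2) by auto
    then show ?thesis using \<open>b \<noteq> j\<close> by simp
  qed
  have less: "height (opener m) i < height (opener m) k" if k: "i < k" "k \<le> j" for k
  proof -
    have "insert i (?T i) \<subseteq> ?T k"
    proof
      fix a assume "a \<in> insert i (?T i)"
      then consider "a = i" | b where "a < i" "i \<le> b" "{a, b} \<in> m" by auto
      then show "a \<in> ?T k"
      proof cases
        case 2
        then show ?thesis using outside[of a b] k by (auto intro!: exI[of _ b])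
      qed (use assms(2) k in \<open>auto intro!: exI[of _ j]\<close>)
    qed
    then have "card (insert i (?T i)) \<le> card (?T k)" by (intro card_mono) auto
    then show ?thesis using k j2 by (simp add: height_opener[OF m])
  qed
  have "?T (Suc j) = ?T i"
  proof (intro set_eqI iffI)
    fix a assume "a \<in> ?T (Suc j)"
    then obtain b where b: "a \<le> j" "j < b" "{a, b} \<in> m" by (auto simp: less_Suc_eq_le Suc_le_eq)
    have "a \<noteq> i" "a \<noteq> j"
      using b assms(2,3) matching_pair_unique[OF m, of i b j] matching_pair_unique[OF m, of j b i]
      by (auto simp: insert_commute)
    then have "\<not> i < a" using nc[of i a j b] b assms(2) by auto
    then have "a < i" using \<open>a \<noteq> i\<close> by simp
    then show "a \<in> ?T i" using b assms(3) by (auto intro!: exI[of _ b])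
  next
    fix a assume "a \<in> ?T i"
    then obtain b where b: "a < i" "i \<le> b" "{a, b} \<in> m" by auto
    then show "a \<in> ?T (Suc j)" using outside[of a b] assms(3) by (auto intro!: exI[of _ b])
  qed
  then have "height (opener m) (Suc j) = height (opener m) i"
    using j2 by (simp add: height_opener[OF m])
  then show ?thesis using less assms(3) by (simp add: match_def)
qed

text \<open>One implication suffices: \<open>i\<close> lies in some pair, and its partner in the
  word is unique.\<close>

lemma non_crossing_partner_iff:
  assumes "m \<in> non_crossing_matchings n" "i < 2 * n"
  shows "{i, j} \<in> m \<longleftrightarrow> partner (opener m) i j"
proof -
  have m: "m \<in> matchings n" using assms by (simp add: non_crossing_matchings_def)
  have *: "partner (opener m) i j" if "{i, j} \<in> m" for j
    using non_crossing_match[OF assms(1)] that matching_pair_less(3)[OF m that]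
    unfolding partner_def by (metis insert_commute linorder_neqE_nat)
  obtain k where "{i, k} \<in> m" using matching_pair_exists[OF m assms(2)] by auto
  then show ?thesis using * partner_unique by metis
qed

lemma opener_outside: "m \<in> matchings n \<Longrightarrow> 2 * n \<le> i \<Longrightarrow> \<not> opener m i"
  by (auto simp: opener_def dest: matching_pair_less)

lemma matching_eqI:
  assumes "m \<in> matchings n" "m' \<in> matchings n"
    and "\<And>i j. i < 2 * n \<Longrightarrow> {i, j} \<in> m \<longleftrightarrow> {i, j} \<in> m'"
  shows "m = m'"
proof -
  have "e \<in> m'" if m: "m \<in> matchings n" "e \<in> m"
    and iff: "\<And>i j. i < 2 * n \<Longrightarrow> {i, j} \<in> m \<longleftrightarrow> {i, j} \<in> m'" for m m' e
  proof -
    have "card e = 2" using m by (auto simp: matchings_def)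
    then obtain a b where "e = {a, b}" by (auto simp: card_2_iff)
    then show ?thesis using m matching_pair_less(1)[of m n a b] iff[of a b] by simp
  qed
  from this[of m _ m'] this[of m' _ m] show ?thesis using assms by blast
qed

lemma inj_on_opener: "inj_on opener (non_crossing_matchings n)"
proof (rule inj_onI)
  fix m m' assume *: "m \<in> non_crossing_matchings n" "m' \<in> non_crossing_matchings n"
    "opener m = opener m'"
  then show "m = m'"
    using non_crossing_partner_iff[OF *(1)] non_crossing_partner_iff[OF *(2)]
    by (intro matching_eqI[of _ n]) (auto simp: non_crossing_matchings_def)
qed

lemma inj_on_word_of: "inj_on word_of (meandric_systems n)"
proof (rule inj_onI)
  fix M M' assume *: "M \<in> meandric_systems n" "M' \<in> meandric_systems n" "word_of M = word_of M'"
  then have "opener (fst M) = opener (fst M')" "opener (snd M) = opener (snd M')"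
    by (auto simp: word_of_def fun_eq_iff)
  then show "M = M'"
    using * by (intro prod_eqI inj_onD[OF inj_on_opener[of n]]) (auto simp: meandric_systems_def)
qed

text \<open>Inside the vertex set, closed means stable under adjacency, because the neighbours of a
  vertex are exactly its two partners. The minimal non-empty stable sets are the reachability
  classes.\<close>

lemma components_eq_loops:
  assumes "M \<in> meandric_systems n"
  shows "components M = loops (word_of M) {..<2 * n}"
proof -
  let ?R = "adjacency M"
  let ?w = "word_of M"
  have nc: "fst M \<in> non_crossing_matchings n" "snd M \<in> non_crossing_matchings n"
    using assms by (auto simp: meandric_systems_def)
  then have m: "fst M \<in> matchings n" "snd M \<in> matchings n"
    by (auto simp: non_crossing_matchings_def)
  have w: "fst \<circ> ?w = opener (fst M)" "snd \<circ> ?w = opener (snd M)"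
    by (auto simp: word_of_def)
  have R_less: "a < 2 * n \<and> b < 2 * n" if "(a, b) \<in> ?R" for a b
    using that matching_pair_less[OF m(1)] matching_pair_less[OF m(2)]
    unfolding adjacency_def by auto
  have "sym ?R" by (auto simp: adjacency_def sym_def insert_commute)
  then have sym: "sym (?R\<^sup>*)" by (rule sym_rtrancl)
  have V: "\<Union> (fst M \<union> snd M) = {..<2 * n}"
    using m by (auto simp: matchings_def partition_on_def)
  have closed_iff: "closed_set ?w C \<longleftrightarrow> ?R `` C \<subseteq> C" if "C \<subseteq> {..<2 * n}" for C
  proof -
    have "linked ?w C v \<longleftrightarrow> ?R `` {v} \<subseteq> C" if v: "v \<in> C" for v
    proof -
      have v2: "v < 2 * n" using v \<open>C \<subseteq> {..<2 * n}\<close> by auto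
      obtain a b where a: "{v, a} \<in> fst M" and b: "{v, b} \<in> snd M"
        using matching_pair_exists[OF m(1) v2] matching_pair_exists[OF m(2) v2] by auto
      have "{v, u} \<in> fst M \<longleftrightarrow> u = a" "{v, u} \<in> snd M \<longleftrightarrow> u = b" for u
        using matching_pair_unique[OF m(1) a, of u] matching_pair_unique[OF m(2) b, of u] a b by blast+
      then have "?R `` {v} = {a, b}" by (auto simp: adjacency_def)
      moreover have "(\<exists>u\<in>C. partner s v u) \<longleftrightarrow> c \<in> C" if "partner s v c" for s c
        using that partner_unique by blast
      then have "linked ?w C v \<longleftrightarrow> a \<in> C \<and> b \<in> C"
        using a b unfolding linked_def w
        by (simp add: non_crossing_partner_iff[OF nc(1) v2] non_crossing_partner_iff[OF nc(2) v2])
      ultimately show ?thesis by simp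
    qed
    then have "closed_set ?w C \<longleftrightarrow> (\<forall>v\<in>C. ?R `` {v} \<subseteq> C)"
      by (simp add: closed_set_def)
    also have "\<dots> \<longleftrightarrow> ?R `` C \<subseteq> C" by blast
    finally show ?thesis .
  qed
  have reach: "?R\<^sup>* `` {v} \<subseteq> C" if "?R `` C \<subseteq> C" "v \<in> C" for v C
    using Image_closed_trancl[OF that(1)] that(2) by blast
  have class_closed: "?R `` (?R\<^sup>* `` {v}) \<subseteq> ?R\<^sup>* `` {v}" for v
    by (auto intro: rtrancl_into_rtrancl)
  have class_less: "?R\<^sup>* `` {v} \<subseteq> {..<2 * n}" if "v < 2 * n" for v
    using that R_less by (intro reach) auto
  have "loop ?w (?R\<^sup>* `` {v})" if v: "v < 2 * n" for v
    unfolding loop_def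
  proof (intro conjI allI impI)
    fix C' assume C': "C' \<subseteq> ?R\<^sup>* `` {v}" "C' \<noteq> {}" "closed_set ?w C'"
    then obtain u where u: "u \<in> C'" by auto
    have "?R `` C' \<subseteq> C'" using C' class_less[OF v] closed_iff[of C'] by simp
    then have "?R\<^sup>* `` {u} \<subseteq> C'" using u by (rule reach)
    moreover have "(v, u) \<in> ?R\<^sup>*" using C'(1) u by blast
    then have "(u, v) \<in> ?R\<^sup>*" using sym by (simp add: symD)
    \<comment> \<open>Symmetry enters here: from any vertex of the class the whole class can be
      reached again, hence no smaller stable set exists.\<close>
    then have "?R\<^sup>* `` {v} \<subseteq> ?R\<^sup>* `` {u}" using rtrancl_trans by fast
    ultimately show "C' = ?R\<^sup>* `` {v}" using C'(1) by simp
  next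
    show "?R\<^sup>* `` {v} \<noteq> {}" by blast
    show "closed_set ?w (?R\<^sup>* `` {v})"
      by (rule iffD2[OF closed_iff[OF class_less[OF v]] class_closed])
  qed
  moreover have "\<exists>v\<in>{..<2 * n}. C = ?R\<^sup>* `` {v}" if C: "C \<subseteq> {..<2 * n}" "loop ?w C" for C
  proof -
    obtain v where v: "v \<in> C" using C by (auto simp: loop_def)
    have v2: "v < 2 * n" using v C by auto
    have "?R `` C \<subseteq> C" using C(2) closed_iff[OF C(1)] by (simp add: loop_def)
    then have "?R\<^sup>* `` {v} \<subseteq> C" using v by (rule reach)
    moreover have "closed_set ?w (?R\<^sup>* `` {v})"
      by (rule iffD2[OF closed_iff[OF class_less[OF v2]] class_closed])
    moreover have "?R\<^sup>* `` {v} \<noteq> {}" by blast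
    ultimately have "?R\<^sup>* `` {v} = C" using C(2) unfolding loop_def by simp
    then show ?thesis using v2 by auto
  qed
  ultimately have "loops ?w {..<2 * n} = (\<lambda>v. ?R\<^sup>* `` {v}) ` {..<2 * n}"
    unfolding loops_def using class_less by (intro set_eqI iffI) (simp add: image_iff, force)
  then show ?thesis unfolding components_def V quotient_def by auto
qed

subsection \<open>Counting non-crossing matchings\<close>

text \<open>A Dyck path is stored as the set of its up-steps, so that it can be compared with the
  \<open>n\<close>-subsets of \<open>{..<2 * n}\<close>.\<close>

definition dyck :: "nat \<Rightarrow> nat set set" where
  "dyck n = {S. S \<subseteq> {..<2 * n} \<and> height (\<lambda>i. i \<in> S) (2 * n) = 0 \<and>
     (\<forall>k\<le>2 * n. 0 \<le> height (\<lambda>i. i \<in> S) k)}"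

text \<open>Both ends of the path have the minimal height 0, so an opener finds its match before the
  end and a closer after the start.\<close>

lemma dyck_partner_exists:
  assumes "S \<in> dyck n" "v < 2 * n"
  shows "\<exists>u<2 * n. partner (\<lambda>i. i \<in> S) v u"
proof (cases "v \<in> S")
  case True
  then show ?thesis
    using opener_match_exists[of "\<lambda>i. i \<in> S" v "2 * n"] assms by (auto simp: dyck_def partner_def)
next
  case False
  then show ?thesis
    using closer_match_exists[of "\<lambda>i. i \<in> S" v 0] assms
    by (auto simp: dyck_def partner_def intro: less_trans)
qed

definition arcs :: "nat set \<Rightarrow> nat \<Rightarrow> nat set set" where
  "arcs S n = {{i, j} | i j. i < 2 * n \<and> j < 2 * n \<and> match (\<lambda>i. i \<in> S) i j}"

lemma arcs_pair_iff:
  "{i, j} \<in> arcs S n \<longleftrightarrow> i < 2 * n \<and> j < 2 * n \<and> partner (\<lambda>i. i \<in> S) i j"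
  by (auto simp: arcs_def partner_def doubleton_eq_iff)

lemma arcs_in_non_crossing_matchings:
  assumes "S \<in> dyck n"
  shows "arcs S n \<in> non_crossing_matchings n"
proof -
  have "\<Union> (arcs S n) = {0..<2 * n}"
  proof (intro equalityI subsetI)
    fix v assume "v \<in> {0..<2 * n}"
    then obtain u where "{v, u} \<in> arcs S n"
      using dyck_partner_exists[OF assms, of v] by (auto simp: arcs_pair_iff)
    then show "v \<in> \<Union> (arcs S n)" by blast
  qed (auto simp: arcs_def)
  moreover have "disjoint (arcs S n)"
  proof (rule disjointI)
    have arc: "\<exists>u. e = {v, u} \<and> partner (\<lambda>i. i \<in> S) v u" if "e \<in> arcs S n" "v \<in> e" for e v
      using that unfolding arcs_def partner_def by (auto simp: insert_commute)
    fix e f assume "e \<in> arcs S n" "f \<in> arcs S n" "e \<noteq> f"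
    then show "e \<inter> f = {}"
      using arc[of e] arc[of f] partner_unique[of "\<lambda>i. i \<in> S"] by (metis disjoint_iff)
  qed
  moreover have "{} \<notin> arcs S n" "\<forall>e\<in>arcs S n. card e = 2"
    unfolding arcs_def by (auto simp: card_2_iff dest!: match_less)
  moreover have "non_crossing (arcs S n)"
    unfolding non_crossing_def
  proof (intro notI, elim exE conjE)
    fix i j k l :: nat
    assume *: "i < j" "j < k" "k < l" "{i, k} \<in> arcs S n" "{j, l} \<in> arcs S n"
    then have m: "match (\<lambda>i. i \<in> S) i k" "match (\<lambda>i. i \<in> S) j l"
      by (auto simp: arcs_pair_iff partner_def dest: match_less)
    \<comment> \<open>A crossing puts \<open>j\<close> strictly above \<open>i\<close>, and
      \<open>Suc k\<close> strictly above \<open>j\<close> because the arc from \<open>j\<close> is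
      still open; yet the arc from \<open>i\<close> has just returned to its level.\<close>
    then have "height (\<lambda>i. i \<in> S) i < height (\<lambda>i. i \<in> S) j"
      "height (\<lambda>i. i \<in> S) j < height (\<lambda>i. i \<in> S) (Suc k)"
      "height (\<lambda>i. i \<in> S) (Suc k) = height (\<lambda>i. i \<in> S) i"
      using * m(1) m(2)[unfolded match_def, THEN conjunct2, THEN conjunct2, rule_format, of "Suc k"]
      unfolding match_def by auto
    then show False by simp
  qed
  ultimately show ?thesis
    by (simp add: non_crossing_matchings_def matchings_def partition_on_def)
qed

lemma finite_non_crossing_matchings: "finite (non_crossing_matchings n)"
  by (rule finite_subset[of _ "Pow (Pow {0..<2 * n})"])
    (auto simp: non_crossing_matchings_def matchings_def partition_on_def)

text \<open>The path is recovered from its arcs as the set of their left endpoints. The count enters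
  later only as a lower bound, so an injection is enough.\<close>

lemma card_dyck_le: "card (dyck n) \<le> card (non_crossing_matchings n)"
proof (rule card_inj_on_le[of "\<lambda>S. arcs S n"])
  show "inj_on (\<lambda>S. arcs S n) (dyck n)"
  proof (rule inj_onI)
    fix S T assume *: "S \<in> dyck n" "T \<in> dyck n" "arcs S n = arcs T n"
    have "v \<in> T" if S: "S \<in> dyck n" "arcs S n = arcs T n" "v \<in> S" for S T v
    proof -
      have v: "v < 2 * n" using S by (auto simp: dyck_def)
      obtain u where u: "u < 2 * n" "partner (\<lambda>i. i \<in> S) v u"
        using dyck_partner_exists[OF S(1) v] by auto
      then have "match (\<lambda>i. i \<in> S) v u" using S by (auto simp: partner_def dest: match_close)
      then have "v < u" by (rule match_less)
      moreover have "partner (\<lambda>i. i \<in> T) v u" using u v S arcs_pair_iff by metis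
      ultimately show ?thesis by (auto simp: partner_def dest: match_less match_open)
    qed
    from this[OF *(1,3)] this[OF *(2) *(3)[symmetric]] show "S = T" by blast
  qed
qed (auto intro: arcs_in_non_crossing_matchings finite_non_crossing_matchings)

section \<open>Lower bound for the number of meandric systems\<close>

lemma height_card: "height s k = 2 * int (card {l. l < k \<and> s l}) - int k"
proof (induction k)
  case (Suc k)
  have "{l. l < Suc k \<and> s l} = (if s k then insert k else id) {l. l < k \<and> s l}"
    by (auto simp: less_Suc_eq)
  then show ?case using Suc by (auto simp: height_Suc)
qed auto

text \<open>Cycle lemma: rotating a balanced word so that it starts at its minimal height makes it Dyck.\<close>

lemma central_binomial_le_dyck:
  assumes "n > 0"
  shows "(2 * n) choose n \<le> 2 * n * card (dyck n)"
proof -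
  let ?N = "2 * n"
  let ?A = "{A. A \<subseteq> {..<?N} \<and> card A = n}"
  define rot where "rot A r = {i. i < ?N \<and> (r + i) mod ?N \<in> A}" for A r
  have "\<exists>r<?N. rot A r \<in> dyck n" if A: "A \<in> ?A" for A
  proof -
    \<comment> \<open>\<open>t\<close> is the periodic extension of the word; its height is periodic
      as well because the word is balanced.\<close>
    define t where "t i \<longleftrightarrow> i mod ?N \<in> A" for i
    have "{l. l < ?N \<and> t l} = A" using A by (auto simp: t_def)
    then have tN: "height t ?N = 0" using A by (simp add: height_card)
    have per: "height t (?N + k) = height t k" for k
    proof -
      have "(\<lambda>l. t (?N + l)) = t" by (simp add: t_def fun_eq_iff)
      then show ?thesis using height_shift[of t ?N k] tN by simp
    qed
    obtain r where r: "r < ?N" "\<And>k. k < ?N \<Longrightarrow> height t r \<le> height t k"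
      using ex_is_arg_min_if_finite[of "{..<?N}" "height t"] assms
      by (auto simp: is_arg_min_linorder lessThan_empty_iff)
    \<comment> \<open>The rotated word reads past the end of the original one, so minimality is
      needed over two periods.\<close>
    have min: "height t r \<le> height t k" if "k < ?N + ?N" for k
    proof (cases "k < ?N")
      case False
      then have "height t k = height t (k - ?N)" using per[of "k - ?N"] by simp
      then show ?thesis using r(2)[of "k - ?N"] that False by simp
    qed (rule r(2))
    have h: "height (\<lambda>i. i \<in> rot A r) k = height t (r + k) - height t r" if "k \<le> ?N" for k
    proof -
      have "height (\<lambda>i. i \<in> rot A r) k = height (\<lambda>l. t (r + l)) k"
        using that by (intro height_cong) (auto simp: rot_def t_def)
      then show ?thesis using height_shift[of t r k] by simp
    qed
    have "rot A r \<in> dyck n"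
      unfolding dyck_def
    proof (intro CollectI conjI allI impI)
      show "height (\<lambda>i. i \<in> rot A r) ?N = 0"
        using h[of ?N] per[of r] by (simp add: add.commute)
      show "0 \<le> height (\<lambda>i. i \<in> rot A r) k" if "k \<le> ?N" for k
        using h[OF that] min[of "r + k"] r(1) that by simp
    qed (auto simp: rot_def)
    then show ?thesis using r by auto
  qed
  then obtain r where r: "\<And>A. A \<in> ?A \<Longrightarrow> r A < ?N \<and> rot A (r A) \<in> dyck n"
    by metis
  have fin: "finite (dyck n)"
    by (rule finite_subset[of _ "Pow {..<?N}"]) (auto simp: dyck_def)
  have mem: "x \<in> A \<longleftrightarrow> (x + (?N - k)) mod ?N \<in> rot A k" if "x < ?N" "k < ?N" for x k A
  proof -
    have "(k + (x + (?N - k)) mod ?N) mod ?N = x"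
      using that by (simp add: mod_add_right_eq)
    then show ?thesis using that by (simp add: rot_def)
  qed
  \<comment> \<open>The rotated word together with the rotation amount determines \<open>A\<close>;
    the \<open>2 * n\<close> possible amounts account for the factor in the bound.\<close>
  have "inj_on (\<lambda>A. (r A, rot A (r A))) ?A"
  proof (rule inj_onI)
    fix A B assume AB: "A \<in> ?A" "B \<in> ?A" "(r A, rot A (r A)) = (r B, rot B (r B))"
    have "x \<in> A \<longleftrightarrow> x \<in> B" if "x < ?N" for x
    proof -
      have "x \<in> A \<longleftrightarrow> (x + (?N - r A)) mod ?N \<in> rot A (r A)"
        using r[OF AB(1)] that by (intro mem) auto
      also have "\<dots> \<longleftrightarrow> (x + (?N - r B)) mod ?N \<in> rot B (r B)" using AB(3) by (metis prod.inject)
      also have "\<dots> \<longleftrightarrow> x \<in> B" using r[OF AB(2)] that by (intro mem[symmetric]) auto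
      finally show ?thesis .
    qed
    then show "A = B" using AB by blast
  qed
  then have "card ?A \<le> card ({..<?N} \<times> dyck n)"
    using r fin by (intro card_inj_on_le) auto
  then show ?thesis using n_subsets[of "{..<?N}" n] by (simp add: card_cartesian_product)
qed

text \<open>The central binomial coefficient is at least \<open>4 ^ n / (2 * n)\<close>, and the
  cycle lemma loses another factor \<open>2 * n\<close>. Squaring for the two matchings gives the
  constant and the power.\<close>

lemma card_meandric_systems_ge:
  assumes "n > 0"
  shows "16 ^ n \<le> 16 * real n ^ 4 * real (card (meandric_systems n))"
proof -
  let ?c = "real (card (non_crossing_matchings n))"
  have "real ((2 * n) choose n) \<le> 2 * real n * real (card (dyck n))"
    using central_binomial_le_dyck[OF assms]
    by (metis (mono_tags, lifting) of_nat_le_iff of_nat_mult of_nat_numeral)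
  also have "\<dots> \<le> 2 * real n * ?c" using card_dyck_le[of n] by (intro mult_left_mono) auto
  finally have "4 ^ n / (2 * real n) \<le> 2 * real n * ?c"
    using central_binomial_lower_bound[OF assms] by linarith
  then have "4 ^ n \<le> 4 * real n ^ 2 * ?c"
    using assms by (simp add: field_simps power2_eq_square)
  then have "(4 ^ n) ^ 2 \<le> (4 * real n ^ 2 * ?c) ^ 2" by (intro power_mono) auto
  moreover have "(4 ^ n) ^ 2 = ((4 :: real) ^ 2) ^ n"
    by (simp only: power_mult[symmetric] mult.commute)
  ultimately show ?thesis
    by (simp add: meandric_systems_def card_cartesian_product power_mult_distrib
        power2_eq_square power4_eq_xxxx mult_ac)
qed

subsection \<open>Concentration of sums over blocks\<close>

definition average :: "'a set \<Rightarrow> ('a \<Rightarrow> real) \<Rightarrow> real" where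
  "average A g = (\<Sum>x\<in>A. g x) / real (card A)"

definition words :: "nat \<Rightarrow> word set" where
  "words L = {..<L} \<rightarrow>\<^sub>E UNIV"

text \<open>Restricting to \<open>{..<L}\<close> makes each block an element of the finite set
  \<open>words L\<close> of extensional functions.\<close>

definition block :: "nat \<Rightarrow> word \<Rightarrow> nat \<Rightarrow> word" where
  "block L w i = restrict (shift (i * L) w) {..<L}"

lemma finite_words: "finite (words L)"
  unfolding words_def by (intro finite_PiE) auto

lemma card_words: "card (words L) = 4 ^ L"
proof -
  have "CARD(bool \<times> bool) = 4" by simp
  then show ?thesis unfolding words_def by (simp only: card_PiE finite_lessThan prod_constant card_lessThan)
qed

text \<open>Hoeffding's inequality for independent uniform samples, multiplied out into a statement
  on cardinalities so that it can be moved along injections.\<close>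

lemma hoeffding_count:
  fixes g :: "'a \<Rightarrow> real"
  assumes A: "finite A" "A \<noteq> {}" and g: "\<And>x. x \<in> A \<Longrightarrow> 0 \<le> g x \<and> g x \<le> b"
    and "b > 0" "q > 0" "t \<ge> 0"
  shows "real (card {x \<in> {..<q} \<rightarrow>\<^sub>E A. \<bar>(\<Sum>i<q. g (x i)) - q * average A g\<bar> \<ge> t})
           \<le> 2 * exp (- 2 * t\<^sup>2 / (q * b\<^sup>2)) * real (card A) ^ q"
proof -
  define P where "P = Pi_pmf {..<q} undefined (\<lambda>_. pmf_of_set A)"
  \<comment> \<open>The uniform distribution on tuples is the product of uniform distributions,
    which supplies the independence.\<close>
  have P: "P = pmf_of_set ({..<q} \<rightarrow>\<^sub>E A)"
    unfolding P_def using A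
    by (subst Pi_pmf_of_set) (auto simp: PiE_dflt_def PiE_def extensional_def intro!: arg_cong[of _ _ pmf_of_set])
  have ne: "finite ({..<q} \<rightarrow>\<^sub>E A)" "{..<q} \<rightarrow>\<^sub>E A \<noteq> {}"
    using A by (auto intro!: finite_PiE simp: PiE_eq_empty_iff)
  have comp: "map_pmf (\<lambda>x. x i) P = pmf_of_set A" if "i < q" for i
    using that by (simp add: P_def Pi_pmf_component)
  have E: "measure_pmf.expectation P (\<lambda>x. g (x i)) = average A g" if "i < q" for i
  proof -
    have "measure_pmf.expectation P (\<lambda>x. g (x i)) = measure_pmf.expectation (map_pmf (\<lambda>x. x i) P) g"
      by simp
    also have "\<dots> = average A g"
      using A by (simp only: comp[OF that]) (simp add: integral_pmf_of_set average_def)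
    finally show ?thesis .
  qed
  have indep: "prob_space.indep_vars (measure_pmf P) (\<lambda>_. borel) (\<lambda>i x. g (x i)) {..<q}"
    unfolding P_def
    by (intro prob_space.indep_vars_compose2[OF _ indep_vars_Pi_pmf])
       (auto simp: measure_pmf.prob_space_axioms)
  interpret Hoeffding_ineq "measure_pmf P" "{..<q}" "\<lambda>i x. g (x i)" "\<lambda>_. 0" "\<lambda>_. b"
    "\<Sum>i<q. measure_pmf.expectation P (\<lambda>x. g (x i))"
  proof unfold_locales
    show "AE x in measure_pmf P. g (x i) \<in> {0..b}" if "i \<in> {..<q}" for i
      using that g ne by (auto simp: AE_measure_pmf_iff P set_pmf_of_set)
  qed (auto simp: indep)
  have "measure_pmf.prob P {x. \<bar>(\<Sum>i<q. g (x i)) - q * average A g\<bar> \<ge> t} \<le> 2 * exp (- 2 * t\<^sup>2 / (q * b\<^sup>2))"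
    using Hoeffding_ineq_abs_ge[OF \<open>t \<ge> 0\<close>] assms by (simp add: E)
  moreover have "measure_pmf.prob P {x. \<bar>(\<Sum>i<q. g (x i)) - q * average A g\<bar> \<ge> t} =
    real (card {x \<in> {..<q} \<rightarrow>\<^sub>E A. \<bar>(\<Sum>i<q. g (x i)) - q * average A g\<bar> \<ge> t}) / real (card A) ^ q"
    unfolding P using ne by (subst measure_pmf_of_set) (auto simp: card_PiE Int_def)
  ultimately show ?thesis using A by (simp add: divide_le_eq card_gt_0_iff)
qed

section \<open>Transfer from independent letters to meandric systems\<close>

text \<open>A word is determined by its first \<open>q\<close> blocks and the
  \<open>N - q * L\<close> remaining letters, each of which has four values.\<close>

lemma card_words_blocks:
  assumes "q * L \<le> N"
  shows "card {w \<in> words N. P (\<lambda>i\<in>{..<q}. block L w i)} \<le>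
    4 ^ (N - q * L) * card {x \<in> {..<q} \<rightarrow>\<^sub>E words L. P x}"
proof -
  let ?rest = "{q * L..<N} \<rightarrow>\<^sub>E (UNIV :: (bool \<times> bool) set)"
  let ?h = "\<lambda>w. (restrict w {q * L..<N}, \<lambda>i\<in>{..<q}. block L w i)"
  have "inj_on ?h (words N)"
  proof (rule inj_onI)
    fix w w' assume w: "w \<in> words N" "w' \<in> words N" "?h w = ?h w'"
    show "w = w'"
    proof
      fix l
      consider "l < q * L" | "q * L \<le> l" "l < N" | "N \<le> l" by linarith
      then show "w l = w' l"
      proof cases
        case 1
        then have "L > 0" by (cases L) auto
        have "l div L < q" using 1 by (simp add: less_mult_imp_div_less)
        then have "block L w (l div L) (l mod L) = block L w' (l div L) (l mod L)"
          using w(3) by (metis (no_types, lifting) lessThan_iff prod.inject restrict_apply')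
        then show ?thesis using \<open>L > 0\<close> by (simp add: block_def)
      next
        case 2
        then show ?thesis using w(3) by (metis (no_types, lifting) atLeastLessThan_iff prod.inject restrict_apply')
      next
        case 3
        then show ?thesis using w by (auto simp: words_def PiE_def extensional_def)
      qed
    qed
  qed
  then have "inj_on ?h {w \<in> words N. P (\<lambda>i\<in>{..<q}. block L w i)}" by (rule inj_on_subset) auto
  moreover have "?h ` {w \<in> words N. P (\<lambda>i\<in>{..<q}. block L w i)} \<subseteq>
    ?rest \<times> {x \<in> {..<q} \<rightarrow>\<^sub>E words L. P x}"
    by (auto simp: block_def words_def)
  moreover have "finite (?rest \<times> {x \<in> {..<q} \<rightarrow>\<^sub>E words L. P x})"
    by (auto intro!: finite_cartesian_product finite_PiE finite_words)
  ultimately have "card {w \<in> words N. P (\<lambda>i\<in>{..<q}. block L w i)} \<le>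
    card (?rest \<times> {x \<in> {..<q} \<rightarrow>\<^sub>E words L. P x})"
    by (rule card_inj_on_le)
  moreover have "card ?rest = 4 ^ (N - q * L)"
    by (simp add: card_PiE flip: UNIV_Times_UNIV)
  ultimately show ?thesis by (simp add: card_cartesian_product)
qed

lemma average_bounds:
  assumes "finite A" "A \<noteq> {}" "\<And>x. x \<in> A \<Longrightarrow> 0 \<le> g x \<and> g x \<le> b"
  shows "0 \<le> average A g" "average A g \<le> b"
proof -
  show "0 \<le> average A g" unfolding average_def using assms by (intro divide_nonneg_nonneg sum_nonneg) auto
  have "sum g A \<le> real (card A) * b" using assms by (intro sum_bounded_above) auto
  then show "average A g \<le> b" unfolding average_def using assms
    by (simp add: divide_le_eq card_gt_0_iff mult.commute)
qed

lemma words_nonempty: "words L \<noteq> {}"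
  by (simp add: words_def PiE_eq_empty_iff)

text \<open>
  Conditioning independent uniform steps on the two words being Dyck costs only a factor
  \<open>16 * n ^ 4\<close>, which the exponential tail bound absorbs.
\<close>

lemma prob_meandric_le:
  assumes "n > 0" "q * L \<le> 2 * n"
  shows "measure_pmf.prob (uniform_meandric_system n) {M. P (\<lambda>i\<in>{..<q}. block L (word_of M) i)} \<le>
    16 * real n ^ 4 * (real (card {x \<in> {..<q} \<rightarrow>\<^sub>E words L. P x}) / (4 ^ L) ^ q)"
proof -
  let ?MS = "meandric_systems n"
  let ?B = "{M. P (\<lambda>i\<in>{..<q}. block L (word_of M) i)}"
  let ?W = "{w \<in> words (2 * n). P (\<lambda>i\<in>{..<q}. block L w i)}"
  let ?r = "\<lambda>M. restrict (word_of M) {..<2 * n}"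
  let ?X = "{x \<in> {..<q} \<rightarrow>\<^sub>E words L. P x}"
  have eq: "(\<lambda>i\<in>{..<q}. block L (restrict w {..<2 * n}) i) = (\<lambda>i\<in>{..<q}. block L w i)" for w :: word
  proof (rule restrict_ext)
    fix i assume "i \<in> {..<q}"
    then have "i * L + L \<le> 2 * n" using mult_le_mono1[of "Suc i" q L] assms(2) by auto
    then show "block L (restrict w {..<2 * n}) i = block L w i"
      by (auto simp: block_def intro!: restrict_ext)
  qed
  \<comment> \<open>Truncation loses nothing, since all letters from \<open>2 * n\<close> on are
    \<open>(False, False)\<close>.\<close>
  have "inj_on ?r ?MS"
  proof (rule inj_onI)
    fix M M' assume M: "M \<in> ?MS" "M' \<in> ?MS" "?r M = ?r M'"
    have "word_of M l = word_of M' l" for l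
    proof (cases "l < 2 * n")
      case True
      then show ?thesis using M(3) by (metis lessThan_iff restrict_apply')
    next
      case False
      then show ?thesis using M opener_outside[of _ n l]
        by (auto simp: word_of_def meandric_systems_def non_crossing_matchings_def)
    qed
    then show "M = M'" using M inj_onD[OF inj_on_word_of] by blast
  qed
  then have inj: "inj_on ?r (?MS \<inter> ?B)" by (rule inj_on_subset) auto
  have "card (?MS \<inter> ?B) \<le> card ?W"
  proof (rule card_inj_on_le[OF inj])
    show "?r ` (?MS \<inter> ?B) \<subseteq> ?W"
    proof (rule image_subsetI)
      fix M assume "M \<in> ?MS \<inter> ?B"
      then have "P (\<lambda>i\<in>{..<q}. block L (?r M) i)" by (simp only: eq Int_iff mem_Collect_eq)
      moreover have "?r M \<in> words (2 * n)" by (simp add: words_def)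
      ultimately show "?r M \<in> ?W" by simp
    qed
  qed (simp add: finite_words)
  also have "\<dots> \<le> 4 ^ (2 * n - q * L) * card ?X" by (rule card_words_blocks[OF assms(2)])
  finally have "real (card (?MS \<inter> ?B)) \<le> 4 ^ (2 * n - q * L) * real (card ?X)"
    by (metis (mono_tags, lifting) of_nat_le_iff of_nat_mult of_nat_numeral of_nat_power)
  \<comment> \<open>The number \<open>4 ^ (2 * n) = 16 ^ n\<close> of all words is compared with the
    number of meandric systems, at the price of the polynomial factor.\<close>
  also have "(4 :: real) ^ (2 * n - q * L) = 16 ^ n / (4 ^ L) ^ q"
    using assms(2) by (simp add: power_diff power_mult mult.commute[of q])
  also have "16 ^ n / (4 ^ L) ^ q * real (card ?X) \<le>
      16 * real n ^ 4 * real (card ?MS) / (4 ^ L) ^ q * real (card ?X)"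
    using card_meandric_systems_ge[OF assms(1)] by (intro mult_right_mono divide_right_mono) auto
  also have "16 * real n ^ 4 * real (card ?MS) / (4 ^ L) ^ q * real (card ?X) =
      16 * real n ^ 4 * (real (card ?X) / (4 ^ L) ^ q) * real (card ?MS)"
    by simp
  finally have "real (card (?MS \<inter> ?B)) \<le>
      16 * real n ^ 4 * (real (card ?X) / (4 ^ L) ^ q) * real (card ?MS)" .
  moreover have "card ?MS > 0"
    using finite_meandric_systems meandric_systems_nonempty by (simp add: card_gt_0_iff)
  ultimately show ?thesis
    unfolding uniform_meandric_system_def
    by (subst measure_pmf_of_set[OF meandric_systems_nonempty finite_meandric_systems])
      (simp only: divide_le_eq of_nat_0_less_iff if_True)
qed

text \<open>For fixed \<open>L\<close> the number of blocks grows linearly in \<open>n\<close>, so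
  the Hoeffding bound decays exponentially and beats the factor \<open>n ^ 4\<close>.\<close>

lemma block_sum_concentration:
  fixes g :: "word \<Rightarrow> real"
  assumes "L > 0" "\<delta> > 0" and "b > 0" and g: "\<And>w. w \<in> words L \<Longrightarrow> 0 \<le> g w \<and> g w \<le> b"
  shows "(\<lambda>n. measure_pmf.prob (uniform_meandric_system n)
    {M. \<bar>(\<Sum>i<2 * n div L. g (block L (word_of M) i)) - real (2 * n div L) * average (words L) g\<bar>
        \<ge> \<delta> * real (2 * n div L)}) \<longlonglongrightarrow> 0"
proof -
  define c where "c = 2 * \<delta>\<^sup>2 / b\<^sup>2"
  define l where "l = real L"
  have c: "c > 0" "l > 0" using assms by (auto simp: c_def l_def)
  let ?bound = "\<lambda>n. 16 * real n ^ 4 * (2 * exp (- c * (2 * real n / l - 1)))"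
  have "?bound \<longlonglongrightarrow> 0" using c by real_asymp
  moreover have "\<forall>\<^sub>F n in sequentially. norm (measure_pmf.prob (uniform_meandric_system n)
    {M. \<bar>(\<Sum>i<2 * n div L. g (block L (word_of M) i)) - real (2 * n div L) * average (words L) g\<bar>
        \<ge> \<delta> * real (2 * n div L)}) \<le> ?bound n"
    using eventually_ge_at_top[of L]
  proof eventually_elim
    case (elim n)
    define q where "q = 2 * n div L"
    have n: "n > 0" using elim \<open>L > 0\<close> by simp
    have q: "q > 0" using elim \<open>L > 0\<close> by (simp add: q_def div_greater_zero_iff)
    have qL: "q * L \<le> 2 * n" unfolding q_def by simp
    have "2 * n < L * q + L"
      unfolding q_def using dividend_less_times_div[OF \<open>L > 0\<close>, of "2 * n"] by simp
    then have "real (2 * n) < real (L * q + L)" by (simp only: of_nat_less_iff)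
    then have q_ge: "2 * real n / l - 1 \<le> real q" using \<open>L > 0\<close> by (simp add: l_def field_simps)
    let ?P = "\<lambda>x. \<bar>(\<Sum>i<q. g (x i)) - real q * average (words L) g\<bar> \<ge> \<delta> * real q"
    have "measure_pmf.prob (uniform_meandric_system n) {M. ?P (\<lambda>i\<in>{..<q}. block L (word_of M) i)} \<le>
        16 * real n ^ 4 * (real (card {x \<in> {..<q} \<rightarrow>\<^sub>E words L. ?P x}) / (4 ^ L) ^ q)"
      by (rule prob_meandric_le[OF n qL])
    also have "\<dots> \<le> 16 * real n ^ 4 * (2 * exp (- 2 * (\<delta> * real q)\<^sup>2 / (q * b\<^sup>2)))"
      using hoeffding_count[OF finite_words words_nonempty g \<open>b > 0\<close> q, where t = "\<delta> * real q"] \<open>\<delta> > 0\<close>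
      by (intro mult_left_mono) (auto simp: divide_le_eq card_words)
    also have "- 2 * (\<delta> * real q)\<^sup>2 / (q * b\<^sup>2) = - c * q"
      using q by (simp add: c_def power2_eq_square)
    also have "16 * real n ^ 4 * (2 * exp (- c * q)) \<le> ?bound n"
      using q_ge c by (intro mult_left_mono) auto
    finally show ?case by (simp add: q_def)
  qed
  ultimately show ?thesis by (rule Lim_null_comparison[rotated])
qed

subsection \<open>Densities of loops and of unmatched vertices\<close>

lemma average_words: "average (words L) g = (\<Sum>w\<in>words L. g w) / 4 ^ L"
  by (simp add: average_def card_words)

section \<open>Few vertices are unmatched in a long block\<close>

text \<open>The height is twice the number of up-steps minus \<open>k\<close>, so a height of
  \<open>2 * t\<close> is a deviation \<open>t\<close> of that number from its mean
  \<open>k / 2\<close>. Single letters are treated as blocks of length 1; \<open>F\<close> will be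
  \<open>fst\<close> or \<open>snd\<close>.\<close>

lemma height_tail:
  fixes F :: "bool \<times> bool \<Rightarrow> bool"
  assumes F: "card {x. F x} = 2" and "k \<le> L" "t > 0"
  shows "real (card {w \<in> words L. \<bar>real_of_int (height (F \<circ> w) k)\<bar> \<ge> 2 * t})
    \<le> 2 * exp (- 2 * t\<^sup>2 / real L) * 4 ^ L"
proof (cases "k = 0")
  case False
  let ?g = "\<lambda>x :: word. of_bool (F (x 0)) :: real"
  let ?P = "\<lambda>x. \<bar>(\<Sum>i<k. ?g (x i)) - real k * average (words 1) ?g\<bar> \<ge> t"
  have "{w \<in> words 1. F (w 0)} = {..<1} \<rightarrow>\<^sub>E {x. F x}"
    unfolding words_def by (intro set_eqI) (simp add: PiE_iff Ball_def conj_commute)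
  then have "card {w \<in> words 1. F (w 0)} = 2" using F by (simp add: card_PiE)
  then have avg: "average (words 1) ?g = 1 / 2"
    unfolding average_words by (simp add: finite_words of_bool_def sum.If_cases Int_def)
  have "\<bar>real_of_int (height (F \<circ> w) k)\<bar> \<ge> 2 * t \<longleftrightarrow> ?P (\<lambda>i\<in>{..<k}. block 1 w i)" for w
  proof -
    have "(\<Sum>i<k. ?g ((\<lambda>i\<in>{..<k}. block 1 w i) i)) = (\<Sum>i<k. of_bool (F (w i)))"
      by (intro sum.cong) (auto simp: block_def)
    also have "\<dots> = real (card {i. i < k \<and> F (w i)})"
      by (simp add: of_bool_def sum.If_cases Int_def)
    moreover have "real_of_int (height (F \<circ> w) k) = 2 * real (card {i. i < k \<and> F (w i)}) - real k"
      by (simp add: height_card)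
    ultimately show ?thesis by (simp only: avg) argo
  qed
  then have "card {w \<in> words L. \<bar>real_of_int (height (F \<circ> w) k)\<bar> \<ge> 2 * t} \<le>
      4 ^ (L - k * 1) * card {x \<in> {..<k} \<rightarrow>\<^sub>E words 1. ?P x}"
    using card_words_blocks[of k 1 L ?P] assms(2) by simp
  then have "real (card {w \<in> words L. \<bar>real_of_int (height (F \<circ> w) k)\<bar> \<ge> 2 * t}) \<le>
      4 ^ (L - k) * real (card {x \<in> {..<k} \<rightarrow>\<^sub>E words 1. ?P x})"
    by (metis (mono_tags, lifting) of_nat_le_iff of_nat_mult of_nat_numeral of_nat_power mult_1_right)
  also have "\<dots> \<le> 4 ^ (L - k) * (2 * exp (- 2 * t\<^sup>2 / (real k * 1\<^sup>2)) * real (card (words 1)) ^ k)"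
    using False assms(3) by (intro mult_left_mono hoeffding_count) (auto simp: finite_words words_nonempty)
  also have "\<dots> = 2 * exp (- 2 * t\<^sup>2 / real k) * 4 ^ L"
    using assms(2) by (simp add: card_words flip: power_add)
  also have "\<dots> \<le> 2 * exp (- 2 * t\<^sup>2 / real L) * 4 ^ L"
    using False assms(2) by (intro mult_right_mono mult_left_mono) (auto intro!: divide_left_mono)
  finally show ?thesis .
qed (use assms in auto)

text \<open>If all heights stay below \<open>\<delta> * L\<close>, few letters are unmatched.
  Otherwise the trivial bound \<open>L\<close> is used, weighted by a union bound over the
  \<open>L + 1\<close> heights.\<close>

lemma sum_unmatched_le:
  fixes F :: "bool \<times> bool \<Rightarrow> bool"
  assumes F: "card {x. F x} = 2" and "\<delta> > 0" "L > 0"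
  shows "(\<Sum>w\<in>words L. real (card {v. v < L \<and> \<not> (\<exists>u<L. partner (F \<circ> w) v u)}))
    \<le> (4 * \<delta> * L + 2 + 2 * real L * (real L + 1) * exp (- \<delta>\<^sup>2 * L / 2)) * 4 ^ L"
proof -
  let ?U = "\<lambda>w. {v. v < L \<and> \<not> (\<exists>u<L. partner (F \<circ> w) v u)}"
  let ?bad = "\<lambda>w k. \<bar>real_of_int (height (F \<circ> w) k)\<bar> \<ge> 2 * (\<delta> * L / 2)"
  have U: "real (card (?U w)) \<le> 4 * (\<delta> * L) + 2 + real L * (\<Sum>k\<le>L. of_bool (?bad w k))" for w
  proof (cases "\<exists>k\<le>L. ?bad w k")
    case True
    then obtain k where k: "k \<le> L" "?bad w k" by blast
    have "real (card (?U w)) \<le> real (card {..<L})"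
      by (intro of_nat_mono card_mono) auto
    also have "\<dots> \<le> real L * (\<Sum>k\<in>{k}. of_bool (?bad w k))" using k by simp
    also have "\<dots> \<le> real L * (\<Sum>k\<le>L. of_bool (?bad w k))"
      using k by (intro mult_left_mono sum_mono2) auto
    finally have "real (card (?U w)) \<le> real L * (\<Sum>k\<le>L. of_bool (?bad w k))" .
    moreover have "0 \<le> 4 * (\<delta> * L) + 2" using assms by simp
    ultimately show ?thesis by linarith
  next
    case False
    have "real (card (?U w)) \<le> 4 * (\<delta> * L) + 2"
    proof (rule card_unmatched_le)
      fix k assume "k \<le> L"
      then have "\<not> ?bad w k" using False by blast
      then show "\<bar>real_of_int (height (F \<circ> w) k)\<bar> \<le> \<delta> * L" by simp
    qed
    then show ?thesis by (rule order_trans) (simp add: sum_nonneg)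
  qed
  have "(\<Sum>w\<in>words L. \<Sum>k\<le>L. of_bool (?bad w k)) = (\<Sum>k\<le>L. real (card {w \<in> words L. ?bad w k}))"
    by (subst sum.swap) (simp add: finite_words of_bool_def sum.If_cases Int_def)
  also have "\<dots> \<le> (\<Sum>k\<le>L. 2 * exp (- 2 * (\<delta> * L / 2)\<^sup>2 / real L) * 4 ^ L)"
    using assms by (intro sum_mono height_tail) auto
  also have "\<dots> = (real L + 1) * (2 * exp (- \<delta>\<^sup>2 * L / 2) * 4 ^ L)"
    using assms by (simp add: power2_eq_square field_simps)
  finally have bad: "(\<Sum>w\<in>words L. \<Sum>k\<le>L. of_bool (?bad w k)) \<le>
    (real L + 1) * (2 * exp (- \<delta>\<^sup>2 * L / 2) * 4 ^ L)" .
  have "(\<Sum>w\<in>words L. real (card (?U w))) \<le>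
      (\<Sum>w\<in>words L. 4 * (\<delta> * L) + 2 + real L * (\<Sum>k\<le>L. of_bool (?bad w k)))"
    by (intro sum_mono U)
  also have "\<dots> = (4 * (\<delta> * L) + 2) * 4 ^ L + real L * (\<Sum>w\<in>words L. \<Sum>k\<le>L. of_bool (?bad w k))"
    by (simp only: sum.distrib sum_constant card_words flip: sum_distrib_left) (simp add: algebra_simps)
  also have "\<dots> \<le> (4 * (\<delta> * L) + 2) * 4 ^ L + real L * ((real L + 1) * (2 * exp (- \<delta>\<^sup>2 * L / 2) * 4 ^ L))"
    by (intro add_left_mono mult_left_mono bad) simp
  also have "\<dots> = (4 * \<delta> * L + 2 + 2 * real L * (real L + 1) * exp (- \<delta>\<^sup>2 * L / 2)) * 4 ^ L"
    by (simp add: algebra_simps)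
  finally show ?thesis .
qed

text \<open>The factor 2 converts a density per vertex into one per unit of size, a system of size
  \<open>n\<close> having \<open>2 * n\<close> vertices.\<close>

definition loop_density :: "nat \<Rightarrow> real" where
  "loop_density L = 2 * average (words L) (\<lambda>w. real (card (loops w {..<L}))) / L"

definition unlinked_density :: "nat \<Rightarrow> real" where
  "unlinked_density L = 2 * average (words L) (\<lambda>w. real (card (unlinked w {..<L}))) / L"

lemma unlinked_density_le:
  assumes "\<delta> > 0" "L > 0"
  shows "unlinked_density L \<le> 16 * \<delta> + 8 / L + 8 * (real L + 1) * exp (- \<delta>\<^sup>2 * L / 2)"
proof -
  let ?U = "\<lambda>F w. {v. v < L \<and> \<not> (\<exists>u<L. partner (F \<circ> w) v u)}"
  let ?b = "4 * \<delta> * L + 2 + 2 * real L * (real L + 1) * exp (- \<delta>\<^sup>2 * L / 2)"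
  have "real (card (unlinked w {..<L})) \<le> real (card (?U fst w)) + real (card (?U snd w))" for w
  proof -
    have "unlinked w {..<L} \<subseteq> ?U fst w \<union> ?U snd w"
      by (auto simp: unlinked_def linked_def)
    then have "card (unlinked w {..<L}) \<le> card (?U fst w \<union> ?U snd w)" by (intro card_mono) auto
    then have "card (unlinked w {..<L}) \<le> card (?U fst w) + card (?U snd w)"
      using card_Un_le order_trans by blast
    then show ?thesis by linarith
  qed
  then have "(\<Sum>w\<in>words L. real (card (unlinked w {..<L}))) \<le>
      (\<Sum>w\<in>words L. real (card (?U fst w)) + real (card (?U snd w)))"
    by (intro sum_mono)
  also have "\<dots> \<le> ?b * 4 ^ L + ?b * 4 ^ L"
  proof -
    have "{x :: bool \<times> bool. fst x} = {(True, True), (True, False)}"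
      "{x :: bool \<times> bool. snd x} = {(True, True), (False, True)}" by auto
    then have "card {x :: bool \<times> bool. fst x} = 2" "card {x :: bool \<times> bool. snd x} = 2" by simp_all
    then show ?thesis
      unfolding sum.distrib using assms by (intro add_mono sum_unmatched_le)
  qed
  also have "\<dots> = 2 * ?b * 4 ^ L" by (simp only: mult_2 distrib_right)
  finally have "average (words L) (\<lambda>w. real (card (unlinked w {..<L}))) \<le> 2 * ?b"
    by (simp only: average_words pos_divide_le_eq zero_less_power zero_less_numeral)
  then have "unlinked_density L \<le> 2 * (2 * ?b) / L"
    unfolding unlinked_density_def using assms by (intro divide_right_mono mult_left_mono) auto
  also have "\<dots> = 16 * \<delta> + 8 / L + 8 * (real L + 1) * exp (- \<delta>\<^sup>2 * L / 2)"
    using assms by (simp add: field_simps)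
  finally show ?thesis .
qed

lemma unlinked_density_small:
  assumes "\<epsilon> > 0"
  shows "\<exists>L\<ge>2. unlinked_density L < \<epsilon>"
proof -
  \<comment> \<open>With this choice the limit \<open>16 * \<delta>\<close> of the bound is
    \<open>\<epsilon> / 2\<close>.\<close>
  define \<delta> where "\<delta> = \<epsilon> / 32"
  have "\<delta> > 0" using assms by (simp add: \<delta>_def)
  then have "(\<lambda>L. 16 * \<delta> + 8 / real L + 8 * (real L + 1) * exp (- \<delta>\<^sup>2 * L / 2)) \<longlonglongrightarrow> 16 * \<delta>"
    by real_asymp
  moreover have "16 * \<delta> < \<epsilon>" using assms by (simp add: \<delta>_def)
  ultimately have "\<forall>\<^sub>F L in sequentially.
      16 * \<delta> + 8 / real L + 8 * (real L + 1) * exp (- \<delta>\<^sup>2 * L / 2) < \<epsilon>"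
    by (rule order_tendstoD)
  then have "\<forall>\<^sub>F L in sequentially. L \<ge> 2 \<and> unlinked_density L < \<epsilon>"
    using eventually_ge_at_top[of 2]
  proof eventually_elim
    case (elim L)
    then show ?case using unlinked_density_le[OF \<open>\<delta> > 0\<close>, of L] by auto
  qed
  then show ?thesis by (metis (no_types, lifting) eventually_sequentially order_refl)
qed

section \<open>Bounds for the loop density\<close>

lemma match_adjacent: "s v \<Longrightarrow> \<not> s (Suc v) \<Longrightarrow> match s v (Suc v)"
  unfolding match_def by (auto simp: height_Suc le_Suc_eq)

text \<open>
  A loop has at least two vertices, and at least three if it visits a vertex \<open>v\<close> from which the upper
  arc, but not the lower one, goes to \<open>v + 1\<close>.
\<close>

lemma card_loops_le:
  "6 * card (loops w {..<L}) + card {v. Suc v < L \<and> w v = (True, True) \<and> w (Suc v) = (False, True)}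
    \<le> 3 * L"
proof -
  let ?D = "{v. Suc v < L \<and> w v = (True, True) \<and> w (Suc v) = (False, True)}"
  let ?\<C> = "loops w {..<L}"
  have fin: "finite ?\<C>" by (rule finite_loops) simp
  have finC: "finite C" if "C \<in> ?\<C>" for C
    using that by (auto simp: loops_def intro: finite_subset)
  have disj: "C \<inter> C' = {}" if "C \<in> ?\<C>" "C' \<in> ?\<C>" "C \<noteq> C'" for C C'
    using that loops_disjoint[of w C C'] by (auto simp: loops_def)
  \<comment> \<open>A loop missing \<open>?D\<close> has at least 2 vertices. One meeting
    \<open>?D\<close> has at least 3, so \<open>6 + card C \<le> 3 * card C\<close> leaves room for
    all its vertices in \<open>?D\<close>.\<close>
  have loop: "6 + card (C \<inter> ?D) \<le> 3 * card C" if C: "C \<in> ?\<C>" for C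
  proof -
    have linked: "linked w C v" if "v \<in> C" for v
      using C that by (auto simp: loops_def loop_def closed_set_def)
    obtain v where v: "v \<in> C" using C by (auto simp: loops_def loop_def)
    obtain u where u: "u \<in> C" "partner (fst \<circ> w) v u" using linked[OF v] by (auto simp: linked_def)
    show ?thesis
    proof (cases "C \<inter> ?D = {}")
      case True
      have "card {v, u} \<le> card C" using finC[OF C] v u by (intro card_mono) auto
      then show ?thesis using True partner_neq[OF u(2)] by simp
    next
      case False
      then obtain x where x: "x \<in> C" "w x = (True, True)" "w (Suc x) = (False, True)" by auto
      obtain y where y: "y \<in> C" "partner (fst \<circ> w) x y" using linked[OF x(1)] by (auto simp: linked_def)
      have "partner (fst \<circ> w) x (Suc x)" using x match_adjacent[of "fst \<circ> w" x] by (simp add: partner_def)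
      then have [simp]: "y = Suc x" using y(2) partner_unique by blast
      obtain z where z: "z \<in> C" "partner (snd \<circ> w) x z" using linked[OF x(1)] by (auto simp: linked_def)
      \<comment> \<open>Both lower letters at \<open>x\<close> and \<open>Suc x\<close> are openers,
        so no lower arc joins these vertices.\<close>
      have "z \<noteq> Suc x"
        using z(2) x match_close[of "snd \<circ> w" x "Suc x"] match_less[of _ "Suc x" x]
        by (auto simp: partner_def)
      moreover have "card {x, y, z} \<le> card C" using finC[OF C] x y z by (intro card_mono) auto
      ultimately have "3 \<le> card C" using partner_neq[OF z(2)] by auto
      moreover have "card (C \<inter> ?D) \<le> card C" using finC[OF C] by (intro card_mono) auto
      ultimately show ?thesis by linarith
    qed
  qed
  have "6 * card ?\<C> + (\<Sum>C\<in>?\<C>. card (C \<inter> ?D)) = (\<Sum>C\<in>?\<C>. 6 + card (C \<inter> ?D))"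
    by (simp add: sum.distrib)
  also have "\<dots> \<le> (\<Sum>C\<in>?\<C>. 3 * card C)" by (intro sum_mono loop)
  also have "\<dots> = 3 * card (\<Union>C\<in>?\<C>. C)"
    using fin finC disj by (subst card_UN_disjoint) (auto simp: sum_distrib_left)
  also have "(\<Sum>C\<in>?\<C>. card (C \<inter> ?D)) = card (\<Union>C\<in>?\<C>. C \<inter> ?D)"
    using fin finC disj by (subst card_UN_disjoint) blast+
  finally have 1: "6 * card ?\<C> + card (\<Union>C\<in>?\<C>. C \<inter> ?D) \<le> 3 * card (\<Union>C\<in>?\<C>. C)" .
  \<comment> \<open>Vertices of \<open>?D\<close> in no loop are paid for by the vertices that the
    loops leave uncovered.\<close>
  have "card ?D \<le> card ((\<Union>C\<in>?\<C>. C \<inter> ?D) \<union> ({..<L} - (\<Union>C\<in>?\<C>. C)))"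
    using fin finC by (intro card_mono) auto
  also have "\<dots> \<le> card (\<Union>C\<in>?\<C>. C \<inter> ?D) + card ({..<L} - (\<Union>C\<in>?\<C>. C))" by (rule card_Un_le)
  also have "card ({..<L} - (\<Union>C\<in>?\<C>. C)) = L - card (\<Union>C\<in>?\<C>. C)"
    using fin finC by (subst card_Diff_subset) (auto simp: loops_def)
  finally have 2: "card ?D \<le> card (\<Union>C\<in>?\<C>. C \<inter> ?D) + (L - card (\<Union>C\<in>?\<C>. C))" .
  have "card (\<Union>C\<in>?\<C>. C) \<le> card {..<L}" by (intro card_mono) (auto simp: loops_def)
  then have "card (\<Union>C\<in>?\<C>. C) \<le> L" by simp
  then show ?thesis using 1 2 by linarith
qed

lemma card_words_two_letters:
  assumes "Suc v < L"
  shows "16 * card {w \<in> words L. w v = a \<and> w (Suc v) = b} = 4 ^ L"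
proof -
  let ?S = "\<lambda>i. if i = v then {a} else if i = Suc v then {b} else UNIV"
  have "w v = a \<and> w (Suc v) = b \<longleftrightarrow> (\<forall>i\<in>{..<L}. w i \<in> ?S i)" for w
  proof
    assume S: "\<forall>i\<in>{..<L}. w i \<in> ?S i"
    show "w v = a \<and> w (Suc v) = b"
      using S[rule_format, of v] S[rule_format, of "Suc v"] assms by simp
  qed simp
  then have "{w \<in> words L. w v = a \<and> w (Suc v) = b} = Pi\<^sub>E {..<L} ?S"
    unfolding words_def by (intro set_eqI) (simp only: mem_Collect_eq PiE_iff, blast)
  then have "card {w \<in> words L. w v = a \<and> w (Suc v) = b} = (\<Prod>i<L. card (?S i))"
    by (simp only: card_PiE finite_lessThan)
  also have "\<dots> = (\<Prod>i\<in>{..<L} - {v, Suc v}. CARD(bool \<times> bool))"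
    by (rule prod.mono_neutral_cong_right) auto
  also have "\<dots> = 4 ^ (L - 2)" using assms by (simp add: card_Diff_subset)
  finally have "16 * card {w \<in> words L. w v = a \<and> w (Suc v) = b} = 4 ^ (2 + (L - 2))"
    by (simp only: power_add) simp
  moreover have "2 + (L - 2) = L" using assms by simp
  ultimately show ?thesis by (simp only:)
qed

text \<open>The pattern in \<open>?D\<close> fixes two of the four-valued letters, so its mean
  number of occurrences is \<open>(L - 1) / 16\<close>; averaging \<open>card_loops_le\<close> then
  bounds the mean number of loops by \<open>(47 * L + 1) / 96\<close>.\<close>

lemma loop_density_le:
  assumes "L \<ge> 2"
  shows "loop_density L \<le> 1 - 1 / 96"
proof -
  let ?D = "\<lambda>w. {v. Suc v < L \<and> w v = (True, True) \<and> w (Suc v) = (False, True)}"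
  have "card (?D w) = (\<Sum>v<L - 1. of_bool (w v = (True, True) \<and> w (Suc v) = (False, True)))" for w
    by (simp add: of_bool_def sum.If_cases Int_def less_diff_conv)
  then have "(\<Sum>w\<in>words L. card (?D w)) =
      (\<Sum>w\<in>words L. \<Sum>v<L - 1. of_bool (w v = (True, True) \<and> w (Suc v) = (False, True)))"
    by (simp only:)
  also have "\<dots> =
      (\<Sum>v<L - 1. \<Sum>w\<in>words L. of_bool (w v = (True, True) \<and> w (Suc v) = (False, True)))"
    by (rule sum.swap)
  also have "\<dots> = (\<Sum>v<L - 1. card {w \<in> words L. w v = (True, True) \<and> w (Suc v) = (False, True)})"
    by (simp add: finite_words of_bool_def sum.If_cases Int_def)
  finally have "16 * (\<Sum>w\<in>words L. card (?D w)) =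
      (\<Sum>v<L - 1. 16 * card {w \<in> words L. w v = (True, True) \<and> w (Suc v) = (False, True)})"
    by (simp only: sum_distrib_left)
  also have "\<dots> = (\<Sum>v<L - 1. 4 ^ L)"
    by (intro sum.cong card_words_two_letters) auto
  finally have D: "16 * (\<Sum>w\<in>words L. card (?D w)) = (L - 1) * 4 ^ L" by simp
  have "(\<Sum>w\<in>words L. 6 * card (loops w {..<L}) + card (?D w)) \<le> (\<Sum>w\<in>words L. 3 * L)"
    by (intro sum_mono card_loops_le)
  then have "6 * (\<Sum>w\<in>words L. card (loops w {..<L})) + (\<Sum>w\<in>words L. card (?D w)) \<le> 3 * L * 4 ^ L"
    by (simp add: sum.distrib sum_distrib_left card_words mult_ac)
  then have "96 * (\<Sum>w\<in>words L. card (loops w {..<L})) + (L - 1) * 4 ^ L \<le> 48 * L * 4 ^ L"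
    using D by linarith
  then have "real (96 * (\<Sum>w\<in>words L. card (loops w {..<L})) + (L - 1) * 4 ^ L) \<le> real (48 * L * 4 ^ L)"
    by (simp only: of_nat_le_iff)
  then have "96 * (\<Sum>w\<in>words L. real (card (loops w {..<L}))) \<le> (47 * real L + 1) * 4 ^ L"
    using assms by (simp add: of_nat_diff) argo
  then have "average (words L) (\<lambda>w. real (card (loops w {..<L}))) \<le> (47 * real L + 1) / 96"
    by (simp add: average_words field_simps)
  then have "loop_density L \<le> 2 * ((47 * real L + 1) / 96) / L"
    unfolding loop_density_def by (intro divide_right_mono mult_left_mono) auto
  \<comment> \<open>The left side is \<open>(47 + 1 / L) / 48\<close>, which for
    \<open>L \<ge> 2\<close> is at most \<open>95 / 96\<close>.\<close>
  also have "\<dots> \<le> 1 - 1 / 96" using assms by (simp add: field_simps)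
  finally show ?thesis .
qed

text \<open>One of the 16 words of length 2 opens both arcs and then closes both, which makes a loop
  on two vertices.\<close>

lemma loop_density_2: "1 / 16 \<le> loop_density 2"
proof -
  let ?P = "\<lambda>w :: word. w 0 = (True, True) \<and> w (Suc 0) = (False, False)"
  have "of_bool (?P w) \<le> real (card (loops w {..<2}))" for w
  proof (cases "?P w")
    case True
    then have p: "partner (fst \<circ> w) 0 (Suc 0)" "partner (snd \<circ> w) 0 (Suc 0)"
      using match_adjacent[of "fst \<circ> w" 0] match_adjacent[of "snd \<circ> w" 0] by (auto simp: partner_def)
    note p' = p[THEN partner_sym]
    have "closed_set w {0, Suc 0}" using p p' by (auto simp: closed_set_def linked_def)
    moreover have "C' = {0, Suc 0}" if "C' \<subseteq> {0, Suc 0}" "C' \<noteq> {}" "closed_set w C'" for C'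
    proof -
      have "\<exists>u\<in>C'. partner (fst \<circ> w) v u" if "v \<in> C'" for v
        using that \<open>closed_set w C'\<close> by (auto simp: closed_set_def linked_def)
      then have "0 \<in> C' \<longleftrightarrow> Suc 0 \<in> C'" using p(1) p'(1) partner_unique by metis
      then show ?thesis using that(1,2) by auto
    qed
    ultimately have "{0, Suc 0} \<in> loops w {..<2}" by (auto simp: loops_def loop_def)
    then have "card (loops w {..<2}) > 0" by (auto simp: card_gt_0_iff finite_loops)
    then show ?thesis by simp
  next
    case False
    then show ?thesis by (simp only: of_bool_def if_False of_nat_0_le_iff)
  qed
  then have "(\<Sum>w\<in>words 2. of_bool (?P w)) \<le> (\<Sum>w\<in>words 2. real (card (loops w {..<2})))"
    by (intro sum_mono)
  moreover have "(\<Sum>w\<in>words 2. of_bool (?P w)) = real (card {w \<in> words 2. ?P w})"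
    by (simp add: finite_words of_bool_def sum.If_cases Int_def)
  moreover have "card {w \<in> words 2. ?P w} = 1"
    using card_words_two_letters[of 0 2 "(True, True)" "(False, False)"] by simp
  ultimately show ?thesis by (simp add: loop_density_def average_words)
qed

subsection \<open>Convergence\<close>

lemma cc_block_bounds:
  assumes M: "M \<in> meandric_systems n" and "L > 0"
  defines "q \<equiv> 2 * n div L"
  shows "(\<Sum>i<q. card (loops (block L (word_of M) i) {..<L})) \<le> cc M"
    and "cc M \<le> (\<Sum>i<q. card (loops (block L (word_of M) i) {..<L})) +
      (\<Sum>i<q. card (unlinked (block L (word_of M) i) {..<L})) + L"
proof -
  let ?w = "word_of M"
  have cc: "cc M = card (loops ?w {..<2 * n})" by (simp add: cc_def components_eq_loops[OF M])
  have loops: "card (loops ?w {i * L..<i * L + L}) = card (loops (block L ?w i) {..<L})" for i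
    unfolding card_loops_shift by (intro arg_cong[of _ _ card] loops_cong) (simp add: block_def)
  have unlinked: "card (unlinked ?w {i * L..<i * L + L}) = card (unlinked (block L ?w i) {..<L})" for i
    unfolding card_unlinked_shift by (intro arg_cong[of _ _ card] unlinked_cong) (simp add: block_def)
  have "q * L \<le> 2 * n" by (simp add: q_def)
  then show "(\<Sum>i<q. card (loops (block L ?w i) {..<L})) \<le> cc M"
    using sum_card_loops_blocks_le[of q L "2 * n" ?w] by (simp add: cc loops)
  have "2 * n - q * L \<le> L"
    using dividend_less_div_times[OF \<open>L > 0\<close>, of "2 * n"] by (simp add: q_def)
  then show "cc M \<le> (\<Sum>i<q. card (loops (block L ?w i) {..<L})) +
      (\<Sum>i<q. card (unlinked (block L ?w i) {..<L})) + L"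
    using card_loops_le_sum_blocks[OF \<open>L > 0\<close>, of ?w "2 * n" q] by (simp add: cc loops unlinked)
qed

text \<open>Every fixed block length brackets \<open>cc M / n\<close> up to
  \<open>\<epsilon>\<close> with high probability; the width of the bracket is the unlinked
  density.\<close>

lemma cc_density_bounds:
  assumes "L > 0" "\<epsilon> > 0"
  shows "(\<lambda>n. measure_pmf.prob (uniform_meandric_system n)
    {M. \<not> (loop_density L - \<epsilon> \<le> real (cc M) / real n \<and>
           real (cc M) / real n \<le> loop_density L + unlinked_density L + \<epsilon>)}) \<longlonglongrightarrow> 0"
proof -
  define f where "f w = real (card (loops w {..<L}))" for w
  define g where "g w = real (card (unlinked w {..<L}))" for w
  \<comment> \<open>There are at most \<open>2 * n / L\<close> blocks, so this tolerance adds up to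
    at most \<open>\<epsilon> * n / 4\<close> for each of the two sums.\<close>
  define \<delta> where "\<delta> = \<epsilon> * L / 8"
  have "\<delta> > 0" using assms by (simp add: \<delta>_def)
  let ?F = "average (words L) f" and ?G = "average (words L) g"
  define bad where "bad h n = {M. \<bar>(\<Sum>i<2 * n div L. h (block L (word_of M) i)) -
    real (2 * n div L) * average (words L) h\<bar> \<ge> \<delta> * real (2 * n div L)}" for h n
  have f: "0 \<le> f w \<and> f w \<le> real L" for w
    using card_loops_le[of w L] by (simp add: f_def)
  have g: "0 \<le> g w \<and> g w \<le> real L" for w
    using card_mono[of "{..<L}" "unlinked w {..<L}"] by (auto simp: g_def unlinked_def)
  have dens: "loop_density L = 2 * ?F / L" "unlinked_density L = 2 * ?G / L"
    by (simp_all add: loop_density_def unlinked_density_def f_def[abs_def] g_def[abs_def])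
  have FG: "0 \<le> ?F" "?F \<le> L" "0 \<le> ?G"
    using average_bounds[OF finite_words words_nonempty f]
      average_bounds(1)[OF finite_words words_nonempty g] by auto
  have conc: "(\<lambda>n. measure_pmf.prob (uniform_meandric_system n) (bad h n)) \<longlonglongrightarrow> 0"
    if "h = f \<or> h = g" for h
    unfolding bad_def using that assms \<open>\<delta> > 0\<close> f g
    by (intro block_sum_concentration[where b = "real L"]) auto
  let ?E = "\<lambda>n. {M. \<not> (loop_density L - \<epsilon> \<le> real (cc M) / real n \<and>
           real (cc M) / real n \<le> loop_density L + unlinked_density L + \<epsilon>)}"
  have "\<forall>\<^sub>F n in sequentially. norm (measure_pmf.prob (uniform_meandric_system n) (?E n)) \<le>
      measure_pmf.prob (uniform_meandric_system n) (bad f n) +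
      measure_pmf.prob (uniform_meandric_system n) (bad g n)"
    \<comment> \<open>Beyond this threshold the contribution \<open>L\<close> of the incomplete
      block is at most \<open>\<epsilon> * n / 4\<close>.\<close>
    using eventually_ge_at_top[of "nat \<lceil>4 * L / \<epsilon>\<rceil> + 1"]
  proof eventually_elim
    case (elim n)
    have n: "n > 0" "4 * L / \<epsilon> \<le> real n" using elim by linarith+
    then have nL: "real L \<le> \<epsilon> * n / 4" using assms by (simp add: field_simps)
    define q where "q = 2 * n div L"
    have "q * L \<le> 2 * n" by (simp add: q_def)
    then have "real (q * L) \<le> real (2 * n)" by (simp only: of_nat_le_iff)
    then have q1: "real q \<le> 2 * n / L" using assms by (simp add: field_simps)
    have "2 * n \<le> q * L + L"
      using dividend_less_div_times[OF \<open>L > 0\<close>, of "2 * n"] by (simp add: q_def)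
    then have "real (2 * n) \<le> real (q * L + L)" by (simp only: of_nat_le_iff)
    then have q2: "2 * n / L \<le> real q + 1" using assms by (simp add: field_simps)
    have \<delta>q: "\<delta> * q \<le> \<epsilon> * n / 4"
    proof -
      have "\<delta> * q \<le> \<delta> * (2 * n / L)" using q1 \<open>\<delta> > 0\<close> by (intro mult_left_mono) auto
      then show ?thesis using assms by (simp add: \<delta>_def)
    qed
    have "M \<in> bad f n \<union> bad g n" if M: "M \<in> meandric_systems n" "M \<in> ?E n" for M
    proof (rule ccontr)
      assume "M \<notin> bad f n \<union> bad g n"
      then have c: "\<bar>(\<Sum>i<q. f (block L (word_of M) i)) - q * ?F\<bar> < \<delta> * q"
        "\<bar>(\<Sum>i<q. g (block L (word_of M) i)) - q * ?G\<bar> < \<delta> * q"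
        by (simp_all add: bad_def q_def not_le)
      have lower: "(\<Sum>i<q. f (block L (word_of M) i)) \<le> cc M"
        using cc_block_bounds(1)[OF M(1) \<open>L > 0\<close>] unfolding q_def f_def
        by (metis of_nat_mono of_nat_sum)
      have upper: "cc M \<le> (\<Sum>i<q. f (block L (word_of M) i)) + (\<Sum>i<q. g (block L (word_of M) i)) + L"
        using of_nat_mono[OF cc_block_bounds(2)[OF M(1) \<open>L > 0\<close>], where 'a = real]
        unfolding q_def f_def g_def by simp
      have dens_n: "loop_density L * n = (2 * n / L) * ?F" "unlinked_density L * n = (2 * n / L) * ?G"
        by (simp_all add: dens)
      have "loop_density L * n = (2 * n / L) * ?F" by (rule dens_n(1))
      \<comment> \<open>Rounding \<open>2 * n / L\<close> down to \<open>q\<close> costs at most one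
        block, hence at most \<open>?F \<le> L\<close> expected loops.\<close>
      also have "\<dots> \<le> (q + 1) * ?F" using q2 FG by (intro mult_right_mono) auto
      also have "\<dots> \<le> q * ?F + L" using FG by (simp add: algebra_simps)
      finally have "loop_density L * n \<le> cc M + \<epsilon> * n" using lower c \<delta>q nL assms by linarith
      then have 1: "loop_density L - \<epsilon> \<le> real (cc M) / real n" using n by (simp add: field_simps)
      have "q * ?F \<le> (2 * n / L) * ?F" using q1 FG by (intro mult_right_mono) auto
      moreover have "q * ?G \<le> (2 * n / L) * ?G" using q1 FG by (intro mult_right_mono) auto
      ultimately have "cc M \<le> loop_density L * n + unlinked_density L * n + \<epsilon> * n"
        unfolding dens_n using upper c \<delta>q nL mult_pos_pos[OF \<open>\<epsilon> > 0\<close>, of "real n"] n by linarith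
      then have "real (cc M) / real n \<le> loop_density L + unlinked_density L + \<epsilon>"
        using n by (simp add: field_simps)
      then show False using 1 M(2) by simp
    qed
    \<comment> \<open>The implication was shown only for actual meandric systems, so monotonicity is
      applied almost everywhere on the support.\<close>
    then have "measure_pmf.prob (uniform_meandric_system n) (?E n) \<le>
        measure_pmf.prob (uniform_meandric_system n) (bad f n \<union> bad g n)"
      by (intro measure_pmf.finite_measure_mono_AE)
        (auto simp: AE_measure_pmf_iff uniform_meandric_system_def finite_meandric_systems meandric_systems_nonempty)
    also have "\<dots> \<le> measure_pmf.prob (uniform_meandric_system n) (bad f n) +
        measure_pmf.prob (uniform_meandric_system n) (bad g n)"
      by (rule measure_Un_le) auto
    finally show ?case by simp
  qed
  moreover have "(\<lambda>n. measure_pmf.prob (uniform_meandric_system n) (bad f n) +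
      measure_pmf.prob (uniform_meandric_system n) (bad g n)) \<longlonglongrightarrow> 0"
    using tendsto_add[OF conc[of f] conc[of g]] by simp
  ultimately show ?thesis by (rule Lim_null_comparison)
qed

theorem theorem1:
  shows "\<exists>\<kappa>::real. 0 < \<kappa> \<and> \<kappa> < 1 \<and>
    (\<forall>\<epsilon>>0. (\<lambda>n. measure_pmf.prob (uniform_meandric_system n)
                {M. \<bar>real (cc M) / real n - \<kappa>\<bar> > \<epsilon>}) \<longlonglongrightarrow> 0)"
proof -
  \<comment> \<open>The supremum starts at 2, where \<open>loop_density_le\<close> gives a uniform
    bound below 1.\<close>
  define \<kappa> where "\<kappa> = (SUP L\<in>{2..}. loop_density L)"
  have bdd: "bdd_above (loop_density ` {2..})"
    using loop_density_le by (intro bdd_aboveI[of _ "1 - 1 / 96"]) auto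
  have le: "loop_density L \<le> \<kappa>" if "L \<ge> 2" for L
    unfolding \<kappa>_def using that bdd by (intro cSUP_upper) auto
  have "0 < \<kappa>" using loop_density_2 le[of 2] by simp
  moreover have "\<kappa> \<le> 1 - 1 / 96" unfolding \<kappa>_def using loop_density_le by (intro cSUP_least) auto
  then have "\<kappa> < 1" by simp
  moreover have "(\<lambda>n. measure_pmf.prob (uniform_meandric_system n)
      {M. \<bar>real (cc M) / real n - \<kappa>\<bar> > \<epsilon>}) \<longlonglongrightarrow> 0" if \<epsilon>: "\<epsilon> > 0" for \<epsilon>
  proof -
    \<comment> \<open>Two block lengths are used. \<open>L\<close> has loop density close to the
      supremum and bounds \<open>cc\<close> from below; \<open>L'\<close> has small unlinked density
      and bounds it from above, as its loop density is at most \<kappa>.\<close>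
    obtain L where L: "L \<ge> 2" "\<kappa> - \<epsilon> / 2 < loop_density L"
      using less_cSUP_iff[OF _ bdd, of "\<kappa> - \<epsilon> / 2"] \<epsilon> unfolding \<kappa>_def by auto
    obtain L' where L': "L' \<ge> 2" "unlinked_density L' < \<epsilon> / 2"
      using unlinked_density_small[of "\<epsilon> / 2"] \<epsilon> by auto
    let ?p = "\<lambda>n. measure_pmf.prob (uniform_meandric_system n)"
    let ?E = "\<lambda>L n. {M. \<not> (loop_density L - \<epsilon> / 2 \<le> real (cc M) / real n \<and>
           real (cc M) / real n \<le> loop_density L + unlinked_density L + \<epsilon> / 2)}"
    have "(\<lambda>n. ?p n (?E L n) + ?p n (?E L' n)) \<longlonglongrightarrow> 0 + 0"
      using L(1) L'(1) \<epsilon> by (intro tendsto_add cc_density_bounds) auto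
    then have lim: "(\<lambda>n. ?p n (?E L n) + ?p n (?E L' n)) \<longlonglongrightarrow> 0" by simp
    have "?p n {M. \<bar>real (cc M) / real n - \<kappa>\<bar> > \<epsilon>} \<le> ?p n (?E L n) + ?p n (?E L' n)" for n
    proof -
      have "{M. \<bar>real (cc M) / real n - \<kappa>\<bar> > \<epsilon>} \<subseteq> ?E L n \<union> ?E L' n"
        using L(2) L'(2) le[OF L'(1)] by auto
      then have "?p n {M. \<bar>real (cc M) / real n - \<kappa>\<bar> > \<epsilon>} \<le> ?p n (?E L n \<union> ?E L' n)"
        by (intro measure_pmf.finite_measure_mono) auto
      also have "\<dots> \<le> ?p n (?E L n) + ?p n (?E L' n)"
        by (rule measure_Un_le) auto
      finally show ?thesis .
    qed
    then show ?thesis by (intro Lim_null_comparison[OF _ lim] always_eventually allI) simp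
  qed
  ultimately show ?thesis by blast
qed

end
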